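(* Let $\alpha\in[-1,1]$, $I:=[-1,1]\setminus\{\alpha\}$, and let $n_2\ge1$ be an integer. Let $K(x)=g_1(x)+g_2(x)\log|x-\alpha|$ for $x\in I$, with $g_1$ and $g_2$ smooth on $[-1,1]$. Then there is a constant $c$, depending on $n_2$ and $\alpha$ (and on the functions $g_1,g_2$), but not on $n_1$ or on the interpolation points, such that for every integer $n_1\ge n_2+2$ and every non-polynomial interpolation operator $\mathcal{S}^{\alpha}_{n_1,n_2}$ based on a set of points in $I$ consisting of the $n_1$ Chebyshev points of the first kind and $n_2$ other distinct points, $$\|K-\mathcal{S}^{\alpha}_{n_1,n_2}K\|_1\le\frac{8c\,\bigl(1+\|\mathcal{S}^{\alpha}_{n_1,n_2}\|_{1,\infty}\bigr)}{\pi\, n_2\,(n_1-1)(n_1-2)\cdots(n_1-n_2)} .$$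
   Context: The $n_1$ Chebyshev points of the first kind are the zeros of $T_{n_1}$, i.e. $\cos\frac{(2j+1)\pi}{2n_1}$, $j=0,\ldots,n_1-1$. For positive integers $n_1,n_2$ with $n=n_1+n_2$, $\alpha\in[-1,1]$ and $I=[-1,1]\setminus\{\alpha\}$, set $$\mathbb{S}^{\alpha}_{n_1,n_2}(I):=\operatorname{span}\{x^j,\;x^k\log|x-\alpha| : j=0,\ldots,n_1-1,\;k=0,\ldots,n_2-1,\;x\in I\}.$$ Given distinct points $x_0,\ldots,x_{n-1}\in I$, the operator $\mathcal{S}^{\alpha}_{n_1,n_2}:C(I)\to\mathbb{S}^{\alpha}_{n_1,n_2}(I)$ maps $f$ to the function $\mathcal{S}^{\alpha}_{n_1,n_2}f\in\mathbb{S}^{\alpha}_{n_1,n_2}(I)$ with $(\mathcal{S}^{\alpha}_{n_1,n_2}f)(x_j)=f(x_j)$ for $j=0,\ldots,n-1$. Standing assumption: all interpolation points lie in $I$ and are such that this interpolation problem is uniquely solvable, so that the operator is well defined. Norms: $\|u\|_1:=\int_{-1}^1|u(t)|\,dt$ for $u\in L^1(I)$; $\|\cdot\|_\infty$ is the supremum norm over $I$; and $$\|\mathcal{S}^{\alpha}_{n_1,n_2}\|_{1,\infty}:=\sup_{f\in C(I),\,\|f\|_\infty\ne0}\frac{\|\mathcal{S}^{\alpha}_{n_1,n_2}f\|_1}{\|f\|_\infty},$$ with the convention $1/\|f\|_\infty=0$ if $f\in C(I)$ is unbounded. Here $C(I)$ denotes all continuous functions on $I$ (possibly unbounded). *)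

theory Defs
  imports "HOL-Analysis.Analysis"
begin

definition punctured :: "real \<Rightarrow> real set" where
  "punctured \<alpha> = {-1..1} - {\<alpha>}"

text \<open>\<open>C\<^sup>\<infinity>\<close> on the closed interval \<open>[-1,1]\<close>; derivatives at the endpoints are one-sided, and
  \<open>D k\<close> is the \<open>k\<close>-th derivative of \<open>g\<close>.\<close>
definition smooth_on_interval :: "(real \<Rightarrow> real) \<Rightarrow> bool" where
  "smooth_on_interval g \<longleftrightarrow>
     (\<exists>D :: nat \<Rightarrow> real \<Rightarrow> real. (\<forall>x\<in>{-1..1}. D 0 x = g x) \<and>
        (\<forall>k. \<forall>x\<in>{-1..1}. (D k has_real_derivative D (Suc k) x) (at x within {-1..1})))"

definition chebyshev_points :: "nat \<Rightarrow> real set" where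
  "chebyshev_points m = (\<lambda>j. cos ((2 * real j + 1) * pi / (2 * real m))) ` {..<m}"

text \<open>The elements are restricted to \<open>I = [-1,1] - {\<alpha>}\<close> (and are \<open>undefined\<close> outside),
  so that equality of elements is equality of functions on \<open>I\<close>.\<close>
definition log_space :: "real \<Rightarrow> nat \<Rightarrow> nat \<Rightarrow> (real \<Rightarrow> real) set" where
  "log_space \<alpha> n1 n2 =
     {s. \<exists>a b :: nat \<Rightarrow> real. s = (\<lambda>x\<in>punctured \<alpha>.
        (\<Sum>j<n1. a j * x ^ j) + (\<Sum>k<n2. b k * (x ^ k * ln \<bar>x - \<alpha>\<bar>)))}"

definition interpolates ::
  "real \<Rightarrow> nat \<Rightarrow> nat \<Rightarrow> real set \<Rightarrow> (real \<Rightarrow> real) \<Rightarrow> (real \<Rightarrow> real) \<Rightarrow> bool" where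
  "interpolates \<alpha> n1 n2 X f s \<longleftrightarrow> s \<in> log_space \<alpha> n1 n2 \<and> (\<forall>x\<in>X. s x = f x)"

definition uniquely_solvable :: "real \<Rightarrow> nat \<Rightarrow> nat \<Rightarrow> real set \<Rightarrow> bool" where
  "uniquely_solvable \<alpha> n1 n2 X \<longleftrightarrow>
     (\<forall>f. continuous_on (punctured \<alpha>) f \<longrightarrow> (\<exists>!s. interpolates \<alpha> n1 n2 X f s))"

text \<open>Only meaningful for node sets \<open>X\<close> that are \<open>uniquely_solvable\<close>, and for \<open>f\<close>
  continuous on \<open>I\<close>.\<close>
definition interp_op ::
  "real \<Rightarrow> nat \<Rightarrow> nat \<Rightarrow> real set \<Rightarrow> (real \<Rightarrow> real) \<Rightarrow> (real \<Rightarrow> real)" where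
  "interp_op \<alpha> n1 n2 X f = (THE s. interpolates \<alpha> n1 n2 X f s)"

definition norm_1 :: "real \<Rightarrow> (real \<Rightarrow> real) \<Rightarrow> ennreal" where
  "norm_1 \<alpha> u = (\<integral>\<^sup>+ x \<in> punctured \<alpha>. ennreal \<bar>u x\<bar> \<partial>lborel)"

definition norm_inf :: "real \<Rightarrow> (real \<Rightarrow> real) \<Rightarrow> ennreal" where
  "norm_inf \<alpha> f = (SUP x \<in> punctured \<alpha>. ennreal \<bar>f x\<bar>)"

text \<open>For unbounded \<open>f\<close> the denominator is \<open>\<infinity>\<close>, and \<open>a / \<infinity> = 0\<close> in \<^typ>\<open>ennreal\<close>;
  this is the convention \<open>1 / norm_inf \<alpha> f = 0\<close> for unbounded \<open>f\<close>.\<close>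
definition op_norm_1_inf :: "real \<Rightarrow> ((real \<Rightarrow> real) \<Rightarrow> (real \<Rightarrow> real)) \<Rightarrow> ennreal" where
  "op_norm_1_inf \<alpha> S =
     (SUP f \<in> {f. continuous_on (punctured \<alpha>) f \<and> norm_inf \<alpha> f \<noteq> 0}.
        norm_1 \<alpha> (S f) / norm_inf \<alpha> f)"

end

theory Submission
  imports Defs "HOL-Computational_Algebra.Polynomial"
begin

text \<open>
  The operator reproduces every \<open>v\<close> in the logarithmic space, so \<open>K - S K = e - S e\<close> with
  \<open>e = K - v\<close>, and it is enough to make the supremum norm of \<open>e\<close> of order \<open>n1\<close> to the power
  \<open>- n2\<close>. Take for the logarithmic part of \<open>v\<close> the Taylor
  polynomial of \<open>g2\<close> at \<open>\<alpha>\<close> of degree \<open>n2 - 1\<close>. Taylor expansion of \<open>g2\<close> to higher order splits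
  the rest of \<open>K\<close> into a function with \<open>2 * n2\<close> bounded derivatives, for which Bernstein
  polynomials and repeated integration give the rate, and multiples of
  \<open>(x - \<alpha>) ^ k * ln \<bar>x - \<alpha>\<bar>\<close> with \<open>k \<ge> n2\<close>. With \<open>x = cos t\<close> and \<open>\<alpha> = cos \<phi>\<close>, the latter come
  from \<open>(1 - z) ^ k * Ln (1 - z)\<close> at \<open>z = cis (\<plusminus> t + \<phi>)\<close>: the power series coefficients of this
  function are \<open>k\<close>-th differences of \<open>1 / i\<close>, so the tails of the series telescope.
\<close>

subsection \<open>Approximation of differentiable functions\<close>

text \<open>This is the variance of a binomial frequency. Writing the square in terms of
  \<open>k * (k - 1)\<close>, \<open>k\<close> and \<open>1\<close> reduces it to the three moment
  sums of the library.\<close>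

lemma Bernstein_variance:
  assumes "n > 0"
  shows "(\<Sum>k\<le>n. (x - real k / real n)\<^sup>2 * Bernstein n k x) = x * (1 - x) / real n"
proof -
  have "(\<Sum>k\<le>n. (x - real k / n)\<^sup>2 * Bernstein n k x) =
    (\<Sum>k\<le>n. real k * (real k - 1) * Bernstein n k x / n\<^sup>2
       + (1 - 2 * (n * x)) * (real k * Bernstein n k x) / n\<^sup>2 + x\<^sup>2 * Bernstein n k x)"
    using assms by (intro sum.cong refl) (simp add: field_simps power2_eq_square)
  also have "\<dots> = (\<Sum>k\<le>n. real k * (real k - 1) * Bernstein n k x) / n\<^sup>2
       + (1 - 2 * (n * x)) * (\<Sum>k\<le>n. real k * Bernstein n k x) / n\<^sup>2
       + x\<^sup>2 * (\<Sum>k\<le>n. Bernstein n k x)"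
    by (simp only: sum.distrib sum_distrib_left sum_divide_distrib)
  also have "\<dots> = x * (1 - x) / n"
    unfolding sum_kk_Bernstein sum_k_Bernstein sum_Bernstein
    using assms by (simp add: field_simps power2_eq_square)
  finally show ?thesis .
qed

text \<open>The approximant is the Bernstein polynomial of \<open>f\<close>, carried over to
  \<open>[-1,1]\<close>. Its error is an average of \<open>f x - f (t k)\<close>, which the
  Lipschitz bound and the variance control.\<close>

lemma Lipschitz_polynomial_approximation:
  fixes f :: "real \<Rightarrow> real"
  assumes lip: "\<And>x y. x \<in> {-1..1} \<Longrightarrow> y \<in> {-1..1} \<Longrightarrow> \<bar>f x - f y\<bar> \<le> L * \<bar>x - y\<bar>"
    and L: "L \<ge> 0" and n: "n > 0"
  shows "\<exists>p. degree p \<le> n \<and> (\<forall>x\<in>{-1..1}. \<bar>f x - poly p x\<bar> \<le> 4 * L / sqrt n)"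
proof -
  \<comment> \<open>\<open>B k\<close> is the Bernstein basis polynomial in
    \<open>(x + 1) / 2\<close>, and \<open>t k\<close> is the node \<open>k / n\<close> mapped to
    \<open>[-1,1]\<close>.\<close>
  define B where "B k = smult (real (n choose k)) ([:1/2, 1/2:] ^ k * [:1/2, -1/2:] ^ (n - k))" for k
  define t where "t k = 2 * real k / n - 1" for k
  define p where "p = (\<Sum>k\<le>n. smult (f (t k)) (B k))"
  have B: "poly (B k) x = Bernstein n k ((x + 1) / 2)" for k x
  proof -
    have "poly [:1/2, 1/2:] x = (x + 1) / 2" "poly [:1/2, -1/2:] x = 1 - (x + 1) / 2"
      by (simp_all add: field_simps)
    then show ?thesis by (simp only: B_def Bernstein_def poly_smult poly_mult poly_power mult.assoc)
  qed
  have "degree (B k) \<le> n" if "k \<le> n" for k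
  proof -
    have "degree (B k) \<le> degree ([:1/2, 1/2:] ^ k :: real poly) + degree ([:1/2, -1/2:] ^ (n - k) :: real poly)"
      unfolding B_def by (intro order.trans[OF degree_smult_le] degree_mult_le)
    also have "\<dots> \<le> 1 * k + 1 * (n - k)"
      by (intro add_mono order.trans[OF degree_power_le]) auto
    finally show ?thesis using that by simp
  qed
  then have "degree p \<le> n"
    unfolding p_def by (intro degree_sum_le order.trans[OF degree_smult_le]) auto
  moreover have "\<bar>f x - poly p x\<bar> \<le> 4 * L / sqrt n" if x: "x \<in> {-1..1}" for x
  proof -
    define y where "y = (x + 1) / 2"
    have y: "0 \<le> y" "y \<le> 1" using x by (auto simp: y_def)
    have nonneg: "0 \<le> Bernstein n k y" for k using y by (rule Bernstein_nonneg)
    have bound: "\<bar>f x - f (t k)\<bar> \<le> 2 * L * (sqrt n * (y - k / n)\<^sup>2 + 1 / sqrt n)" if "k \<le> n" for k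
    proof -
      have "t k \<in> {-1..1}" using that n by (auto simp: t_def field_simps)
      then have "\<bar>f x - f (t k)\<bar> \<le> L * \<bar>x - t k\<bar>" using lip x by blast
      also have "x - t k = 2 * (y - k / n)" using n by (simp add: y_def t_def field_simps)
      \<comment> \<open>The distance is traded for its square, so that the variance applies without
        the Cauchy-Schwarz inequality. The weight \<open>sqrt n\<close> balances the two terms after
        averaging.\<close>
      also have "\<bar>y - k / n\<bar> \<le> sqrt n * (y - k / n)\<^sup>2 + 1 / sqrt n"
      proof (cases "\<bar>y - k / n\<bar> \<le> 1 / sqrt n")
        case False
        then have "1 \<le> sqrt n * \<bar>y - k / n\<bar>" using n by (simp add: field_simps)
        then have "1 * \<bar>y - k / n\<bar> \<le> (sqrt n * \<bar>y - k / n\<bar>) * \<bar>y - k / n\<bar>"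
          by (intro mult_right_mono) auto
        also have "\<dots> = sqrt n * (y - k / n)\<^sup>2"
          by (simp add: power2_eq_square abs_mult[symmetric])
        finally show ?thesis by (smt (verit) divide_nonneg_nonneg real_sqrt_ge_zero of_nat_0_le_iff)
      qed (auto intro: add_increasing)
      then have "L * \<bar>2 * (y - k / n)\<bar> \<le> L * (2 * (sqrt n * (y - k / n)\<^sup>2 + 1 / sqrt n))"
        using L by (intro mult_left_mono) auto
      finally show ?thesis by (simp add: mult_ac)
    qed
    have "f x - poly p x = (\<Sum>k\<le>n. (f x - f (t k)) * Bernstein n k y)"
      by (simp add: p_def poly_sum B y_def left_diff_distrib sum_subtractf flip: sum_distrib_left)
    also have "\<bar>\<dots>\<bar> \<le> (\<Sum>k\<le>n. \<bar>(f x - f (t k)) * Bernstein n k y\<bar>)"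
      by (rule sum_abs)
    also have "\<dots> \<le> (\<Sum>k\<le>n. 2 * L * (sqrt n * (y - k / n)\<^sup>2 + 1 / sqrt n) * Bernstein n k y)"
      using bound nonneg by (intro sum_mono) (auto simp: abs_mult intro!: mult_right_mono)
    also have "\<dots> = 2 * L * sqrt n * (\<Sum>k\<le>n. (y - k / n)\<^sup>2 * Bernstein n k y)
                  + 2 * L / sqrt n * (\<Sum>k\<le>n. Bernstein n k y)"
      unfolding sum_distrib_left by (simp add: sum.distrib[symmetric] algebra_simps)
    also have "\<dots> = 2 * L * sqrt n * (y * (1 - y) / n) + 2 * L / sqrt n"
      using n by (simp add: Bernstein_variance)
    also have "\<dots> \<le> 2 * L * sqrt n * (1 / n) + 2 * L / sqrt n"
      using y L n by (intro add_mono mult_left_mono divide_right_mono) (auto simp: mult_le_one)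
    also have "\<dots> = 4 * L / sqrt n"
      using n by (simp add: field_simps)
    finally show ?thesis .
  qed
  ultimately show ?thesis by blast
qed

text \<open>Only the last derivative has to be bounded, and it may be discontinuous: a bound on
  \<open>u'\<close> already makes \<open>u\<close> Lipschitz. Derivatives are taken within
  \<open>{-1..1}\<close>, hence one-sided at the endpoints.\<close>

primrec bounded_deriv :: "nat \<Rightarrow> (real \<Rightarrow> real) \<Rightarrow> bool" where
  "bounded_deriv 0 u \<longleftrightarrow> (\<exists>B. \<forall>x\<in>{-1..1}. \<bar>u x\<bar> \<le> B)"
| "bounded_deriv (Suc r) u \<longleftrightarrow>
     (\<exists>u'. (\<forall>x\<in>{-1..1}. (u has_real_derivative u' x) (at x within {-1..1})) \<and> bounded_deriv r u')"

lemma bounded_deriv_add: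
  "bounded_deriv r u \<Longrightarrow> bounded_deriv r v \<Longrightarrow> bounded_deriv r (\<lambda>x. u x + v x)"
proof (induction r arbitrary: u v)
  case 0
  then obtain A B where "\<forall>x\<in>{-1..1}. \<bar>u x\<bar> \<le> A" "\<forall>x\<in>{-1..1}. \<bar>v x\<bar> \<le> B" by auto
  then have "\<forall>x\<in>{-1..1}. \<bar>u x + v x\<bar> \<le> A + B" by (smt (verit))
  then show ?case by auto
next
  case (Suc r)
  then obtain u' v' where
    "\<forall>x\<in>{-1..1}. (u has_real_derivative u' x) (at x within {-1..1})" "bounded_deriv r u'"
    "\<forall>x\<in>{-1..1}. (v has_real_derivative v' x) (at x within {-1..1})" "bounded_deriv r v'"
    by auto
  with Suc.IH[of u' v'] show ?case
    by (auto intro!: exI[of _ "\<lambda>x. u' x + v' x"] DERIV_add)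
qed

lemma bounded_deriv_cmult:
  "bounded_deriv r u \<Longrightarrow> bounded_deriv r (\<lambda>x. c * u x)"
proof (induction r arbitrary: u)
  case 0
  then obtain A where "\<forall>x\<in>{-1..1}. \<bar>u x\<bar> \<le> A" by auto
  then have "\<forall>x\<in>{-1..1}. \<bar>c * u x\<bar> \<le> \<bar>c\<bar> * A" by (auto simp: abs_mult intro: mult_left_mono)
  then show ?case by auto
next
  case (Suc r)
  then obtain u' where
    "\<forall>x\<in>{-1..1}. (u has_real_derivative u' x) (at x within {-1..1})" "bounded_deriv r u'"
    by auto
  with Suc.IH[of u'] show ?case
    by (auto intro!: exI[of _ "\<lambda>x. c * u' x"] DERIV_cmult)
qed

section \<open>Approximation rates by repeated integration\<close>

lemma poly_antiderivative:
  fixes q :: "real poly"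
  shows "\<exists>p. pderiv p = q \<and> degree p \<le> Suc (degree q)"
proof -
  define p where "p = (\<Sum>i\<le>degree q. monom (coeff q i / real (Suc i)) (Suc i))"
  have "pderiv p = (\<Sum>i\<le>degree q. monom (coeff q i) i)"
    unfolding p_def using higher_pderiv_sum[of 1 "\<lambda>i. monom (coeff q i / real (Suc i)) (Suc i)" "{..degree q}"]
    by (simp add: pderiv_monom del: of_nat_Suc)
  also have "\<dots> = q" by (rule poly_as_sum_of_monoms)
  finally have "pderiv p = q" .
  moreover have "degree p \<le> Suc (degree q)"
    unfolding p_def by (intro degree_sum_le order.trans[OF degree_monom_le]) auto
  ultimately show ?thesis by blast
qed

text \<open>Bernstein polynomials gain only half an order per derivative; this suffices because
  arbitrarily many derivatives are available wherever the lemma is applied.\<close>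
lemma bounded_deriv_polynomial_approximation:
  "bounded_deriv r u \<Longrightarrow>
   \<exists>C\<ge>0. \<forall>n>0. \<exists>p. degree p \<le> n + r \<and> (\<forall>x\<in>{-1..1}. \<bar>u x - poly p x\<bar> \<le> C / sqrt n ^ r)"
proof (induction r arbitrary: u)
  case 0
  then obtain B where "\<forall>x\<in>{-1..1}. \<bar>u x\<bar> \<le> B" by auto
  then show ?case by (intro exI[of _ "\<bar>B\<bar>"]) (auto intro!: exI[of _ 0])
next
  case (Suc r)
  then obtain u' where
    u': "\<forall>x\<in>{-1..1}. (u has_real_derivative u' x) (at x within {-1..1})" "bounded_deriv r u'"
    by auto
  from Suc.IH[OF u'(2)] obtain C where C: "C \<ge> 0" and
    approx: "\<forall>n>0. \<exists>p. degree p \<le> n + r \<and> (\<forall>x\<in>{-1..1}. \<bar>u' x - poly p x\<bar> \<le> C / sqrt n ^ r)"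
    by auto
  have "\<exists>p. degree p \<le> n + Suc r \<and> (\<forall>x\<in>{-1..1}. \<bar>u x - poly p x\<bar> \<le> 4 * C / sqrt n ^ Suc r)"
    if n: "n > 0" for n
  proof -
    from approx n obtain q where q: "degree q \<le> n + r"
      "\<forall>x\<in>{-1..1}. \<bar>u' x - poly q x\<bar> \<le> C / sqrt n ^ r" by auto
    \<comment> \<open>Integrating the approximant of \<open>u'\<close> leaves the remainder
      \<open>u - p\<close> with the small Lipschitz constant \<open>C / sqrt n ^ r\<close>;
      approximating this remainder once more gains the next factor
      \<open>1 / sqrt n\<close>.\<close>
    obtain p where p: "pderiv p = q" "degree p \<le> Suc (degree q)"
      using poly_antiderivative by blast
    have "\<bar>(u x - poly p x) - (u y - poly p y)\<bar> \<le> C / sqrt n ^ r * \<bar>x - y\<bar>"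
      if "x \<in> {-1..1}" "y \<in> {-1..1}" for x y
    proof -
      have "((\<lambda>x. u x - poly p x) has_real_derivative u' x - poly q x) (at x within {-1..1})"
        if "x \<in> {-1..1}" for x
        using u'(1) that p(1)
        by (auto intro!: DERIV_diff DERIV_subset[OF poly_DERIV[of p]])
      from field_differentiable_bound[OF _ this, of "C / sqrt n ^ r" x y] that q(2)
      show ?thesis by auto
    qed
    from Lipschitz_polynomial_approximation[OF this _ n] C obtain s where s: "degree s \<le> n"
      "\<forall>x\<in>{-1..1}. \<bar>u x - poly p x - poly s x\<bar> \<le> 4 * (C / sqrt n ^ r) / sqrt n"
      by auto
    show ?thesis
      using s p q by (intro exI[of _ "p + s"]) (auto simp: mult_ac diff_diff_eq intro: degree_add_le)
  qed
  then show ?case using C by (intro exI[of _ "4 * C"]) auto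
qed

subsection \<open>Powers times logarithm on the unit disc\<close>

text \<open>For \<open>k > m\<close> this is the coefficient of \<open>z ^ k\<close> in
  \<open>(-1) ^ Suc m * (1 - z) ^ m * Ln (1 - z)\<close>; the sign makes it positive. The case
  \<open>m = 0\<close> is \<open>1 / k\<close>.\<close>

definition log_tail_coeff :: "nat \<Rightarrow> nat \<Rightarrow> real" where
  "log_tail_coeff m k = fact m / (\<Prod>i\<le>m. real k - real i)"

lemma log_tail_coeff_pos: "m < k \<Longrightarrow> 0 < log_tail_coeff m k"
  unfolding log_tail_coeff_def by (intro divide_pos_pos prod_pos) auto

text \<open>The two denominators share the factors in \<open>P\<close>. The remaining factors
  \<open>k\<close> and \<open>k - Suc m\<close> differ by \<open>Suc m\<close>, which turns
  \<open>fact m\<close> into \<open>fact (Suc m)\<close>.\<close>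

lemma log_tail_coeff_diff:
  assumes "Suc m < k"
  shows "log_tail_coeff m (k - 1) - log_tail_coeff m k = log_tail_coeff (Suc m) k"
proof -
  define P where "P = (\<Prod>i<m. real k - real (Suc i))"
  have P: "P > 0" unfolding P_def using assms by (intro prod_pos) auto
  have shift: "real (k - 1) - real i = real k - real (Suc i)" for i using assms by simp
  have 1: "(\<Prod>i\<le>m. real (k - 1) - real i) = P * (real k - real (Suc m))"
    unfolding shift P_def by (simp add: prod.lessThan_Suc flip: lessThan_Suc_atMost del: of_nat_Suc)
  have 2: "(\<Prod>i\<le>m. real k - real i) = real k * P"
    unfolding P_def lessThan_Suc_atMost[symmetric] by (subst prod.lessThan_Suc_shift) simp
  have 3: "(\<Prod>i\<le>Suc m. real k - real i) = real k * P * (real k - real (Suc m))"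
    by (simp add: 2 del: of_nat_Suc)
  define b where "b = real k - real (Suc m)"
  have "real k \<noteq> 0" "b \<noteq> 0" "fact (Suc m) = (real k - b) * fact m"
    using assms by (auto simp: b_def)
  then show ?thesis
    unfolding log_tail_coeff_def 1 2 3 b_def[symmetric] using P by (simp add: divide_simps) (simp add: algebra_simps)
qed

text \<open>The sum telescopes to \<open>log_tail_coeff m n - log_tail_coeff m (n + j)\<close>, and
  the subtracted term is positive. The bound is uniform in \<open>j\<close>.\<close>

lemma log_tail_coeff_sum:
  assumes "m < n"
  shows "(\<Sum>i<j. log_tail_coeff (Suc m) (i + Suc n)) \<le> log_tail_coeff m n"
proof -
  have "(\<Sum>i<j. log_tail_coeff (Suc m) (i + Suc n)) = log_tail_coeff m n - log_tail_coeff m (n + j)"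
  proof (induction j)
    case (Suc j)
    then show ?case using log_tail_coeff_diff[of m "j + Suc n"] assms by (simp add: add.commute)
  qed simp
  then show ?thesis using log_tail_coeff_pos[of m "n + j"] assms by simp
qed

text \<open>The shift by \<open>m\<close> keeps each of the \<open>Suc m\<close> factors of the
  denominator at least \<open>n\<close>.\<close>

lemma log_tail_coeff_le:
  assumes "n > 0"
  shows "log_tail_coeff m (n + m) \<le> fact m / real n ^ Suc m"
proof -
  have "(\<Prod>i\<le>m. real n) \<le> (\<Prod>i\<le>m. real (n + m) - real i)"
    by (intro prod_mono) auto
  then have "real n ^ Suc m \<le> (\<Prod>i\<le>m. real (n + m) - real i)" by simp
  then show ?thesis
    unfolding log_tail_coeff_def using assms by (intro divide_left_mono mult_pos_pos prod_pos) auto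
qed

text \<open>Multiplication by \<open>z - 1\<close> replaces the coefficients by their differences,
  which are the coefficients for \<open>Suc m\<close>. The polynomial \<open>q\<close> collects
  everything up to degree \<open>n\<close>.\<close>

lemma log_power_series_tail:
  "n \<ge> m \<Longrightarrow> \<exists>q :: complex poly. degree q \<le> n \<and> (\<forall>z. norm z < 1 \<longrightarrow>
     (\<lambda>i. of_real (log_tail_coeff m (i + Suc n)) * z ^ (i + Suc n)) sums
       ((-1) ^ Suc m * (1 - z) ^ m * Ln (1 - z) - poly q z))"
proof (induction m arbitrary: n)
  case 0
  \<comment> \<open>The summand \<open>k = 0\<close> vanishes because \<open>1 / 0 = 0\<close>, as
    does the corresponding term of the series.\<close>
  define q where "q = (\<Sum>k\<le>n. monom (1 / of_nat k :: complex) k)"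
  have "degree q \<le> n"
    unfolding q_def by (intro degree_sum_le order.trans[OF degree_monom_le]) auto
  moreover have "(\<lambda>i. of_real (log_tail_coeff 0 (i + Suc n)) * z ^ (i + Suc n)) sums
       (- Ln (1 - z) - poly q z)" if "norm z < 1" for z
  proof -
    have "(\<lambda>k. - (z ^ k / of_nat k)) sums Ln (1 - z)"
      using Ln_series'[of "-z"] that by simp
    from sums_minus[OF this] have "(\<lambda>k. z ^ k / of_nat k) sums - Ln (1 - z)" by simp
    then have "(\<lambda>i. z ^ (i + Suc n) / of_nat (i + Suc n)) sums
        (- Ln (1 - z) - (\<Sum>k<Suc n. z ^ k / of_nat k))"
      by (subst sums_iff_shift)
        (simp del: of_nat_Suc sum.lessThan_Suc)
    moreover have "(\<Sum>k<Suc n. z ^ k / of_nat k) = poly q z"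
      by (simp add: q_def poly_sum poly_monom lessThan_Suc_atMost)
    ultimately show ?thesis by (simp add: log_tail_coeff_def mult.commute)
  qed
  ultimately show ?case by auto
next
  case (Suc m)
  \<comment> \<open>The induction hypothesis is used at \<open>n - 1\<close>, since multiplication
    by \<open>1 - z\<close> raises the degree of the polynomial by one.\<close>
  then obtain n' where n: "n = Suc n'" "n' \<ge> m" by (cases n) auto
  from Suc.IH[OF n(2)] obtain q :: "complex poly" where q: "degree q \<le> n'"
    "\<And>z. norm z < 1 \<Longrightarrow> (\<lambda>i. of_real (log_tail_coeff m (i + Suc n')) * z ^ (i + Suc n')) sums
       ((-1) ^ Suc m * (1 - z) ^ m * Ln (1 - z) - poly q z)" by auto
  \<comment> \<open>The leading term \<open>a * z ^ n\<close> of the old tail has no partner in the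
    series shifted by \<open>z\<close>, so it joins the polynomial.\<close>
  define a where "a = complex_of_real (log_tail_coeff m n)"
  define q' where "q' = - (monom a n + [:1, -1:] * q)"
  have "degree ([:1, -1:] * q) \<le> n"
    using degree_mult_le[of "[:1, -1:]" q] q(1) n by auto
  then have "degree q' \<le> n"
    unfolding q'_def degree_minus by (intro degree_add_le degree_monom_le)
  moreover have "(\<lambda>i. of_real (log_tail_coeff (Suc m) (i + Suc n)) * z ^ (i + Suc n)) sums
       ((-1) ^ Suc (Suc m) * (1 - z) ^ Suc m * Ln (1 - z) - poly q' z)" if z: "norm z < 1" for z
  proof -
    define S where "S = (-1) ^ Suc m * (1 - z) ^ m * Ln (1 - z) - poly q z"
    have s: "(\<lambda>i. of_real (log_tail_coeff m (i + n)) * z ^ (i + n)) sums S"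
      using q(2)[OF z] by (simp add: S_def n)
    then have "(\<lambda>i. of_real (log_tail_coeff m (i + n)) * z ^ (i + n) * z) sums (S * z)"
      by (rule sums_mult2)
    moreover from s have "(\<lambda>i. of_real (log_tail_coeff m (Suc i + n)) * z ^ (Suc i + n)) sums (S - a * z ^ n)"
      by (subst sums_Suc_iff) (simp add: a_def)
    ultimately have "(\<lambda>i. of_real (log_tail_coeff m (i + n)) * z ^ (i + n) * z -
        of_real (log_tail_coeff m (Suc i + n)) * z ^ (Suc i + n)) sums (S * z - (S - a * z ^ n))"
      by (rule sums_diff)
    also have "(\<lambda>i. of_real (log_tail_coeff m (i + n)) * z ^ (i + n) * z -
        of_real (log_tail_coeff m (Suc i + n)) * z ^ (Suc i + n)) =
        (\<lambda>i. of_real (log_tail_coeff (Suc m) (i + Suc n)) * z ^ (i + Suc n))"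
    proof
      fix i
      have "log_tail_coeff (Suc m) (i + Suc n) = log_tail_coeff m (i + n) - log_tail_coeff m (Suc i + n)"
        using log_tail_coeff_diff[of m "i + Suc n"] n by simp
      show "of_real (log_tail_coeff m (i + n)) * z ^ (i + n) * z -
        of_real (log_tail_coeff m (Suc i + n)) * z ^ (Suc i + n) =
        of_real (log_tail_coeff (Suc m) (i + Suc n)) * z ^ (i + Suc n)"
        unfolding \<open>log_tail_coeff (Suc m) (i + Suc n) = _\<close> of_real_diff
        by (simp add: algebra_simps)
    qed
    also have "S * z - (S - a * z ^ n) =
        (-1) ^ Suc (Suc m) * (1 - z) ^ Suc m * Ln (1 - z) - poly q' z"
      by (simp add: S_def q'_def poly_monom algebra_simps)
    finally show ?thesis .
  qed
  ultimately show ?case by auto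
qed

text \<open>Inside the disc the tail is at most the sum of its positive coefficients, which
  telescopes. A radial limit carries the bound to every boundary point except the singularity
  \<open>1\<close>.\<close>

lemma log_polynomial_approximation_disc:
  assumes n: "n > 0"
  shows "\<exists>q :: complex poly. degree q \<le> n + m \<and> (\<forall>z. norm z \<le> 1 \<longrightarrow> z \<noteq> 1 \<longrightarrow>
     norm ((1 - z) ^ Suc m * Ln (1 - z) - poly q z) \<le> fact m / real n ^ Suc m)"
proof -
  define N where "N = n + m"
  define E :: real where "E = fact m / real n ^ Suc m"
  have N: "N \<ge> Suc m" using n by (simp add: N_def)
  from log_power_series_tail[OF this] obtain q :: "complex poly" where q: "degree q \<le> N"
    "\<And>z. norm z < 1 \<Longrightarrow> (\<lambda>i. of_real (log_tail_coeff (Suc m) (i + Suc N)) * z ^ (i + Suc N)) sums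
       ((-1) ^ m * (1 - z) ^ Suc m * Ln (1 - z) - poly q z)" by auto
  have inside: "norm ((-1) ^ m * (1 - z) ^ Suc m * Ln (1 - z) - poly q z) \<le> E" if z: "norm z < 1" for z
  proof (rule Lim_norm_ubound[OF _ q(2)[OF z, unfolded sums_def]])
    show "\<forall>\<^sub>F j in sequentially. norm (\<Sum>i<j. of_real (log_tail_coeff (Suc m) (i + Suc N)) * z ^ (i + Suc N)) \<le> E"
    proof (rule always_eventually, rule allI)
      fix j
      have "norm (\<Sum>i<j. of_real (log_tail_coeff (Suc m) (i + Suc N)) * z ^ (i + Suc N)) \<le>
          (\<Sum>i<j. log_tail_coeff (Suc m) (i + Suc N))"
      proof (rule sum_norm_le)
        fix i
        have "0 < log_tail_coeff (Suc m) (i + Suc N)" using N by (intro log_tail_coeff_pos) simp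
        then show "norm (of_real (log_tail_coeff (Suc m) (i + Suc N)) * z ^ (i + Suc N)) \<le>
            log_tail_coeff (Suc m) (i + Suc N)"
          using z by (auto simp: norm_mult norm_power intro!: mult_left_le power_le_one mult_le_one)
      qed
      also have "\<dots> \<le> log_tail_coeff m N" using N by (intro log_tail_coeff_sum) simp
      also have "\<dots> \<le> E" unfolding E_def N_def by (rule log_tail_coeff_le[OF n])
      finally show "norm (\<Sum>i<j. of_real (log_tail_coeff (Suc m) (i + Suc N)) * z ^ (i + Suc N)) \<le> E" .
    qed
  qed simp
  have closed: "norm ((-1) ^ m * (1 - z) ^ Suc m * Ln (1 - z) - poly q z) \<le> E"
    if z: "norm z \<le> 1" "z \<noteq> 1" for z
  proof (rule Lim_norm_ubound)
    let ?f = "\<lambda>z. (-1) ^ m * (1 - z) ^ Suc m * Ln (1 - z) - poly q z"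
    \<comment> \<open>This keeps \<open>1 - z\<close> off the branch cut, so that \<open>Ln\<close>
      is continuous there and the radial limit exists.\<close>
    have "Re z < 1"
    proof (rule ccontr)
      assume "\<not> Re z < 1"
      with z(1) complex_Re_le_cmod[of z] have "Re z = 1" "norm z = 1" by auto
      then show False using z(2) by (auto simp: cmod_def complex_eq_iff)
    qed
    then have "1 - z \<notin> \<real>\<^sub>\<le>\<^sub>0" by (auto simp: complex_nonpos_Reals_iff)
    then have "isCont ?f z" by (intro continuous_intros) auto
    moreover have "((\<lambda>r. of_real r * z) \<longlongrightarrow> of_real 1 * z) (at_left (1::real))"
      by (intro tendsto_intros)
    ultimately show "((\<lambda>r. ?f (of_real r * z)) \<longlongrightarrow> ?f z) (at_left (1::real))"
      by (intro isCont_tendsto_compose[of z ?f]) simp_all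
    have "\<forall>\<^sub>F r in at_left (1::real). 0 < r \<and> r < 1"
      using eventually_at_left_real[of 0 1] by (auto elim: eventually_mono)
    then show "\<forall>\<^sub>F r in at_left (1::real). norm (?f (of_real r * z)) \<le> E"
    proof (rule eventually_mono)
      fix r :: real assume r: "0 < r \<and> r < 1"
      then have "norm (of_real r * z) \<le> r * 1" using z by (simp add: norm_mult mult_left_le)
      then have "norm (of_real r * z) < 1" using r by linarith
      then show "norm (?f (of_real r * z)) \<le> E" by (rule inside)
    qed
  qed simp
  have "norm ((1 - z) ^ Suc m * Ln (1 - z) - poly (smult ((-1) ^ m) q) z) \<le> E"
    if "norm z \<le> 1" "z \<noteq> 1" for z
  proof -
    have "(1 - z) ^ Suc m * Ln (1 - z) - poly (smult ((-1) ^ m) q) z =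
      (-1) ^ m * ((-1) ^ m * (1 - z) ^ Suc m * Ln (1 - z) - poly q z)"
      by (simp add: right_diff_distrib mult.assoc[symmetric] flip: power_mult_distrib)
    then show ?thesis using closed[OF that] by (simp add: norm_mult norm_power)
  qed
  moreover have "degree (smult ((-1) ^ m) q) \<le> n + m" using q(1) by (simp add: N_def)
  ultimately show ?thesis unfolding E_def by blast
qed

subsection \<open>From the disc to the interval\<close>

text \<open>These are the Chebyshev polynomials of the first kind, obtained from their three-term
  recurrence.\<close>

lemma cos_multiple_poly:
  "\<exists>p :: real poly. degree p \<le> n \<and> (\<forall>t. cos (real n * t) = poly p (cos t))"
proof (induction n rule: induct_nat_012)
  case 0
  then show ?case by (intro exI[of _ 1]) simp
next
  case 1
  then show ?case by (intro exI[of _ "[:0, 1:]"]) simp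
next
  case (ge2 n)
  then obtain p q :: "real poly" where p: "degree p \<le> n" "\<And>t. cos (real n * t) = poly p (cos t)"
    and q: "degree q \<le> Suc n" "\<And>t. cos (real (Suc n) * t) = poly q (cos t)" by blast
  have "degree ([:0, 2:] * q) \<le> Suc (Suc n)"
    using degree_mult_le[of "[:0, 2:]" q] q(1) by simp
  then have "degree ([:0, 2:] * q - p) \<le> Suc (Suc n)"
    using p(1) by (intro degree_diff_le) auto
  moreover have "cos (real (Suc (Suc n)) * t) = poly ([:0, 2:] * q - p) (cos t)" for t
  proof -
    have "cos (real (Suc (Suc n)) * t) + cos (real n * t) = 2 * cos t * cos (real (Suc n) * t)"
      using cos_plus_cos[of "real (Suc (Suc n)) * t" "real n * t"]
      by (simp add: algebra_simps add_divide_distrib)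
    then show ?thesis by (simp add: p(2) q(2)[symmetric] del: of_nat_Suc)
  qed
  ultimately show ?case by blast
qed

text \<open>Adding the terms for \<open>t\<close> and \<open>- t\<close> cancels the sines and
  leaves \<open>2 * Re (coeff P k) * cos ((k - m) * t)\<close> for each \<open>k\<close>. The
  frequency shift by \<open>m\<close> arises because each factor \<open>cos t - \<alpha>\<close>
  contributes a factor \<open>cis (- t)\<close>.\<close>

lemma even_trigonometric_poly:
  fixes P :: "complex poly"
  assumes "degree P \<le> n + m"
  shows "\<exists>p :: real poly. degree p \<le> n + m \<and>
    (\<forall>t. Re (cis (- real m * t) * poly P (cis t)) + Re (cis (real m * t) * poly P (cis (- t)))
        = poly p (cos t))"
proof -
  have "\<exists>p :: real poly. degree p \<le> n + m \<and> (\<forall>t. cos ((real k - real m) * t) = poly p (cos t))"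
    if k: "k \<le> n + m" for k
  proof (cases "m \<le> k")
    case True
    obtain p :: "real poly" where p: "degree p \<le> k - m" "\<And>t. cos (real (k - m) * t) = poly p (cos t)"
      using cos_multiple_poly by blast
    show ?thesis using p k True by (intro exI[of _ p]) (auto simp: of_nat_diff)
  next
    case False
    obtain p :: "real poly" where p: "degree p \<le> m - k" "\<And>t. cos (real (m - k) * t) = poly p (cos t)"
      using cos_multiple_poly by blast
    have "cos ((real k - real m) * t) = cos (real (m - k) * t)" for t
      using False cos_minus[of "(real k - real m) * t"] by (simp add: of_nat_diff algebra_simps)
    then show ?thesis using p False by (intro exI[of _ p]) auto
  qed
  then obtain T :: "nat \<Rightarrow> real poly" where T:
    "\<And>k. k \<le> n + m \<Longrightarrow> degree (T k) \<le> n + m"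
    "\<And>k t. k \<le> n + m \<Longrightarrow> cos ((real k - real m) * t) = poly (T k) (cos t)" by metis
  define p where "p = (\<Sum>k\<le>degree P. smult (2 * Re (coeff P k)) (T k))"
  have "degree p \<le> n + m"
    unfolding p_def using assms T(1)
    by (intro degree_sum_le order.trans[OF degree_smult_le]) auto
  moreover have "Re (cis (- real m * t) * poly P (cis t)) + Re (cis (real m * t) * poly P (cis (- t)))
        = poly p (cos t)" for t
  proof -
    have cis1: "cis (- real m * t) * cis t ^ k = cis ((real k - real m) * t)" for k
      unfolding Complex.DeMoivre cis_mult by (rule arg_cong[where f = cis]) algebra
    have cis2: "cis (real m * t) * cis (- t) ^ k = cis (- ((real k - real m) * t))" for k
      unfolding Complex.DeMoivre cis_mult by (rule arg_cong[where f = cis]) algebra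
    have 1: "cis (- real m * t) * poly P (cis t) = (\<Sum>k\<le>degree P. coeff P k * cis ((real k - real m) * t))"
      unfolding poly_altdef sum_distrib_left
      by (intro sum.cong refl) (simp only: cis1[symmetric] mult.left_commute)
    have 2: "cis (real m * t) * poly P (cis (- t)) = (\<Sum>k\<le>degree P. coeff P k * cis (- ((real k - real m) * t)))"
      unfolding poly_altdef sum_distrib_left
      by (intro sum.cong refl) (simp only: cis2[symmetric] mult.left_commute)
    have 3: "Re (c * cis y) + Re (c * cis (- y)) = 2 * Re c * cos y" for c y by simp
    show ?thesis
      unfolding 1 2 p_def Re_sum poly_sum sum.distrib[symmetric] 3 poly_smult
      by (intro sum.cong refl arg_cong2[where f = "(*)"] T(2)) (use assms in simp)
  qed
  ultimately show ?thesis by blast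
qed

text \<open>With \<open>x = cos t\<close> and \<open>\<alpha> = cos \<phi>\<close>, the number
  \<open>2 * \<bar>x - \<alpha>\<bar>\<close> is the product of the norms of
  \<open>1 - cis (t + \<phi>)\<close> and \<open>1 - cis (- t + \<phi>)\<close>. So the logarithm
  splits into two real parts of \<open>Ln (1 - z)\<close>, and the power of
  \<open>x - \<alpha>\<close> supplies the power of \<open>1 - z\<close> required by the estimate on
  the disc.\<close>

lemma log_power_polynomial_approximation:
  assumes \<alpha>: "\<alpha> \<in> {-1..1}"
  shows "\<exists>C\<ge>0. \<forall>n>0. \<exists>p :: real poly. degree p \<le> n + 2 * Suc m \<and>
    (\<forall>x\<in>{-1..1} - {\<alpha>}. \<bar>(x - \<alpha>) ^ Suc m * ln \<bar>x - \<alpha>\<bar> - poly p x\<bar> \<le> C / real n ^ Suc m)"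
proof (intro exI[of _ "2 * fact m :: real"] conjI allI impI)
  fix n :: nat assume n: "n > 0"
  define M where "M = Suc m"
  define E :: real where "E = fact m / real n ^ M"
  define \<phi> where "\<phi> = arccos \<alpha>"
  have cos_\<phi>: "cos \<phi> = \<alpha>" using \<alpha> by (simp add: \<phi>_def)
  from log_polynomial_approximation_disc[OF n] obtain q :: "complex poly" where q: "degree q \<le> n + m"
    "\<And>z. norm z \<le> 1 \<Longrightarrow> z \<noteq> 1 \<Longrightarrow> norm ((1 - z) ^ M * Ln (1 - z) - poly q z) \<le> E"
    unfolding E_def M_def by blast
  \<comment> \<open>From \<open>cos t - \<alpha> = cis (- t) * v * (1 - z) / 2\<close> with
    \<open>v = 1 - cis (t - \<phi>)\<close> and \<open>z = cis (t + \<phi>)\<close>: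
    \<open>P\<close> combines \<open>(v / 2) ^ M\<close> with the approximant \<open>q\<close> of
    the remaining factor at \<open>z\<close>, and \<open>cis (- t) ^ M\<close> stays
    outside.\<close>
  define P where "P = smult ((1/2) ^ M) ([:1, - cis (-\<phi>):] ^ M * (q \<circ>\<^sub>p [:0, cis \<phi>:]))"
  have "degree ([:1, - cis (-\<phi>):] ^ M) \<le> M"
    using degree_power_le[of "[:1, - cis (-\<phi>):]" M] by simp
  moreover have "degree (q \<circ>\<^sub>p [:0, cis \<phi>:]) \<le> n + m"
    using degree_pcompose_le[of q "[:0, cis \<phi>:]"] q(1) by simp
  ultimately have "degree P \<le> (n + M) + M"
    unfolding P_def by (intro order.trans[OF degree_smult_le] order.trans[OF degree_mult_le]) (simp add: M_def)
  from even_trigonometric_poly[OF this] obtain r :: "real poly" where r: "degree r \<le> n + M + M"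
    "\<And>t. Re (cis (- real M * t) * poly P (cis t)) + Re (cis (real M * t) * poly P (cis (- t)))
        = poly r (cos t)" by blast
  \<comment> \<open>One of the two logarithms. It is applied at \<open>t\<close> and at
    \<open>- t\<close>, which have the same cosine.\<close>
  have half: "\<bar>(cos t - \<alpha>) ^ M * ln (norm (1 - cis (t + \<phi>))) - Re (cis (- real M * t) * poly P (cis t))\<bar> \<le> E"
    if t: "cos t \<noteq> \<alpha>" for t
  proof -
    define z where "z = cis (t + \<phi>)"
    define v where "v = 1 - cis (t - \<phi>)"
    have "z \<noteq> 1"
    proof
      assume "z = 1"
      then have "cos (t + \<phi>) = 1" "sin (t + \<phi>) = 0" by (auto simp: z_def complex_eq_iff)
      then have "cos (t + \<phi> - \<phi>) = cos \<phi>" by (subst cos_diff) simp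
      then show False using t cos_\<phi> by simp
    qed
    have fact: "of_real (cos t - \<alpha>) = (1/2) * cis (- t) * v * (1 - z)"
    proof -
      have "cis (- t) * v * (1 - z) = cis (- t) - cis (- t) * cis (t - \<phi>) - cis (- t) * cis (t + \<phi>)
          + cis (- t) * cis (t - \<phi>) * cis (t + \<phi>)"
        unfolding v_def z_def by algebra
      also have "\<dots> = cis (- t) + cis t - (cis \<phi> + cis (- \<phi>))"
        by (simp add: cis_mult)
      also have "\<dots> = 2 * of_real (cos t - cos \<phi>)"
        by (simp add: complex_eq_iff)
      finally show ?thesis by (simp add: cos_\<phi>)
    qed
    have pow: "of_real ((cos t - \<alpha>) ^ M) = (1/2) ^ M * cis (- t) ^ M * v ^ M * (1 - z) ^ M"
      unfolding of_real_power fact by (simp only: power_mult_distrib)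
    have cisM: "cis (- t) ^ M = cis (- real M * t)" by (simp add: Complex.DeMoivre)
    have polyP: "poly P (cis t) = (1/2) ^ M * v ^ M * poly q z"
      by (simp add: P_def poly_pcompose v_def z_def cis_mult add.commute)
    have "(cos t - \<alpha>) ^ M * ln (norm (1 - z)) = Re (of_real ((cos t - \<alpha>) ^ M) * Ln (1 - z))"
      using \<open>z \<noteq> 1\<close> by simp
    also have "of_real ((cos t - \<alpha>) ^ M) * Ln (1 - z)
        = (1/2) ^ M * cis (- real M * t) * v ^ M * ((1 - z) ^ M * Ln (1 - z))"
      unfolding pow cisM by (simp only: mult.assoc)
    finally have "(cos t - \<alpha>) ^ M * ln (norm (1 - z)) - Re (cis (- real M * t) * poly P (cis t))
      = Re ((1/2) ^ M * cis (- real M * t) * v ^ M * ((1 - z) ^ M * Ln (1 - z) - poly q z))"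
      unfolding polyP by (simp add: right_diff_distrib mult_ac)
    also have "\<bar>\<dots>\<bar> \<le> norm ((1/2) ^ M * cis (- real M * t) * v ^ M * ((1 - z) ^ M * Ln (1 - z) - poly q z))"
      by (rule abs_Re_le_cmod)
    also have "\<dots> = (norm v / 2) ^ M * norm ((1 - z) ^ M * Ln (1 - z) - poly q z)"
      by (simp add: norm_mult norm_power norm_divide power_divide)
    also have "\<dots> \<le> 1 * E"
    proof (intro mult_mono)
      have "norm v \<le> 2" unfolding v_def using norm_triangle_ineq4[of 1 "cis (t - \<phi>)"] by simp
      then show "(norm v / 2) ^ M \<le> 1" by (intro power_le_one) auto
      show "norm ((1 - z) ^ M * Ln (1 - z) - poly q z) \<le> E"
        using \<open>z \<noteq> 1\<close> by (intro q(2)) (auto simp: z_def)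
    qed auto
    finally show ?thesis by (simp add: z_def)
  qed
  \<comment> \<open>The subtracted polynomial accounts for the \<open>ln 2\<close> that comes from
    the factor 2 in \<open>2 * \<bar>x - \<alpha>\<bar>\<close>.\<close>
  define p where "p = r - smult (ln 2) ([:-\<alpha>, 1:] ^ M)"
  have "degree ([:-\<alpha>, 1:] ^ M) \<le> n + 2 * M"
    using degree_power_le[of "[:-\<alpha>, 1:]" M] by simp
  then have "degree p \<le> n + 2 * M"
    unfolding p_def using r(1) by (intro degree_diff_le order.trans[OF degree_smult_le]) auto
  moreover have "\<bar>(x - \<alpha>) ^ M * ln \<bar>x - \<alpha>\<bar> - poly p x\<bar> \<le> 2 * fact m / real n ^ M"
    if x: "x \<in> {-1..1} - {\<alpha>}" for x
  proof -
    define t where "t = arccos x"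
    have t: "cos t = x" using x by (simp add: t_def)
    have "norm (1 - cis (t + \<phi>)) * norm (1 - cis (- t + \<phi>)) = 2 * \<bar>x - \<alpha>\<bar>"
    proof -
      have "norm (1 - cis (t + \<phi>)) * norm (1 - cis (- t + \<phi>)) = norm ((1 - cis (t + \<phi>)) * (1 - cis (- t + \<phi>)))"
        by (simp add: norm_mult)
      also have "(1 - cis (t + \<phi>)) * (1 - cis (- t + \<phi>)) =
          1 - cis (t + \<phi>) - cis (- t + \<phi>) + cis (t + \<phi>) * cis (- t + \<phi>)"
        by (simp add: algebra_simps)
      also have "\<dots> = cis \<phi> * (cis (- \<phi>) - cis t - cis (- t) + cis \<phi>)"
        by (simp add: algebra_simps cis_mult)
      also have "\<dots> = cis \<phi> * of_real (2 * (cos \<phi> - cos t))"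
        by (auto simp: complex_eq_iff algebra_simps)
      finally show ?thesis
        unfolding norm_mult norm_of_real norm_cis t cos_\<phi> abs_mult by (simp add: abs_minus_commute)
    qed
    moreover from this have "norm (1 - cis (t + \<phi>)) > 0" "norm (1 - cis (- t + \<phi>)) > 0"
      using x by auto
    ultimately have "ln (norm (1 - cis (t + \<phi>))) + ln (norm (1 - cis (- t + \<phi>))) = ln 2 + ln \<bar>x - \<alpha>\<bar>"
      using x by (simp flip: ln_mult_pos)
    then have lnx: "ln \<bar>x - \<alpha>\<bar> = ln (norm (1 - cis (t + \<phi>))) + ln (norm (1 - cis (- t + \<phi>))) - ln 2"
      by simp
    have h1: "\<bar>(x - \<alpha>) ^ M * ln (norm (1 - cis (t + \<phi>))) - Re (cis (- real M * t) * poly P (cis t))\<bar> \<le> E"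
      using half[of t] x by (simp add: t)
    have h2: "\<bar>(x - \<alpha>) ^ M * ln (norm (1 - cis (- t + \<phi>))) - Re (cis (real M * t) * poly P (cis (- t)))\<bar> \<le> E"
      using half[of "- t"] x by (simp add: t)
    have "(x - \<alpha>) ^ M * ln \<bar>x - \<alpha>\<bar> - poly p x =
      ((x - \<alpha>) ^ M * ln (norm (1 - cis (t + \<phi>))) - Re (cis (- real M * t) * poly P (cis t))) +
      ((x - \<alpha>) ^ M * ln (norm (1 - cis (- t + \<phi>))) - Re (cis (real M * t) * poly P (cis (- t))))"
      using r(2)[of t] unfolding lnx p_def by (simp add: t algebra_simps)
    then show ?thesis using h1 h2 unfolding E_def by linarith
  qed
  ultimately show "\<exists>p :: real poly. degree p \<le> n + 2 * Suc m \<and>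
    (\<forall>x\<in>{-1..1} - {\<alpha>}. \<bar>(x - \<alpha>) ^ Suc m * ln \<bar>x - \<alpha>\<bar> - poly p x\<bar> \<le> 2 * fact m / real n ^ Suc m)"
    unfolding M_def by blast
qed simp

subsection \<open>Products with the logarithm that remain differentiable\<close>

lemma bounded_deriv_cong:
  assumes "bounded_deriv r u" and eq: "\<And>x. x \<in> {-1..1} \<Longrightarrow> u x = v x"
  shows "bounded_deriv r v"
proof (cases r)
  case (Suc r')
  with assms(1) obtain u' where
    "\<forall>x\<in>{-1..1}. (u has_real_derivative u' x) (at x within {-1..1})" "bounded_deriv r' u'"
    by auto
  then have "\<forall>x\<in>{-1..1}. (v has_real_derivative u' x) (at x within {-1..1})"
    using eq by (auto intro: has_field_derivative_transform_within[where d = 1])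
  with \<open>bounded_deriv r' u'\<close> Suc show ?thesis by auto
qed (use assms in auto)

lemma smooth_on_interval_bounded_deriv:
  assumes "smooth_on_interval g"
  shows "bounded_deriv r g"
proof -
  obtain D where D: "\<And>x. x \<in> {-1..1} \<Longrightarrow> D 0 x = g x"
    "\<And>k x. x \<in> {-1..1} \<Longrightarrow> (D k has_real_derivative D (Suc k) x) (at x within {-1..1})"
    using assms unfolding smooth_on_interval_def by blast
  have "bounded_deriv r (D k)" for k
  proof (induction r arbitrary: k)
    case 0
    have "continuous_on {-1..1} (D k)" using D(2) by (intro DERIV_continuous_on)
    then have "bounded (D k ` {-1..1})"
      by (intro compact_imp_bounded compact_continuous_image) auto
    then show ?case by (auto simp: bounded_iff)
  next
    case (Suc r)
    then show ?case using D(2)[of _ k] by (auto intro!: exI[of _ "D (Suc k)"])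
  qed
  then show ?thesis using D(1) by (rule bounded_deriv_cong)
qed

text \<open>This supplies Taylor polynomials: integrate a solution for the shifted data, then
  correct the constant term. The degree is left open, since later all powers of
  \<open>x - \<alpha>\<close> from \<open>m\<close> on are treated alike.\<close>

lemma poly_with_derivatives:
  "\<exists>P :: real poly. \<forall>i<n. poly ((pderiv ^^ i) P) a = d i"
proof (induction n arbitrary: d)
  case (Suc n)
  from Suc.IH[of "\<lambda>i. d (Suc i)"] obtain Q :: "real poly" where
    Q: "\<And>i. i < n \<Longrightarrow> poly ((pderiv ^^ i) Q) a = d (Suc i)" by blast
  obtain P where P: "pderiv P = Q" using poly_antiderivative by blast
  define P' where "P' = P + [:d 0 - poly P a:]"
  have "pderiv P' = Q" by (simp add: P'_def pderiv_add P pderiv_pCons)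
  have "poly ((pderiv ^^ i) P') a = d i" if "i < Suc n" for i
  proof (cases i)
    case (Suc j)
    then show ?thesis using Q[of j] that \<open>pderiv P' = Q\<close> by (simp add: funpow_swap1)
  qed (simp add: P'_def)
  then show ?case by blast
qed simp

text \<open>The Taylor estimate at a zero of order \<open>n\<close>. The bound on the next
  derivative is integrated along the segment from \<open>a\<close> to \<open>x\<close>, on which the
  distance to \<open>a\<close> is at most \<open>\<bar>x - a\<bar>\<close>.\<close>

lemma higher_zero_bound:
  fixes D :: "nat \<Rightarrow> real \<Rightarrow> real"
  assumes D: "\<And>k x. x \<in> {-1..1} \<Longrightarrow> (D k has_real_derivative D (Suc k) x) (at x within {-1..1})"
    and a: "a \<in> {-1..1}"
  shows "(\<And>l. i \<le> l \<Longrightarrow> l < i + n \<Longrightarrow> D l a = 0) \<Longrightarrow>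
    \<exists>C\<ge>0. \<forall>x\<in>{-1..1}. \<bar>D i x\<bar> \<le> C * \<bar>x - a\<bar> ^ n"
proof (induction n arbitrary: i)
  case 0
  have "continuous_on {-1..1} (D i)" using D by (intro DERIV_continuous_on)
  then have "bounded (D i ` {-1..1})"
    by (intro compact_imp_bounded compact_continuous_image) auto
  then obtain B where "\<forall>x\<in>{-1..1}. \<bar>D i x\<bar> \<le> B" by (auto simp: bounded_iff)
  then show ?case by (intro exI[of _ "\<bar>B\<bar>"]) auto
next
  case (Suc n)
  from Suc.IH[of "Suc i"] Suc.prems obtain C where C: "C \<ge> 0"
    "\<And>x. x \<in> {-1..1} \<Longrightarrow> \<bar>D (Suc i) x\<bar> \<le> C * \<bar>x - a\<bar> ^ n" by auto
  have "\<bar>D i x\<bar> \<le> C * \<bar>x - a\<bar> ^ Suc n" if x: "x \<in> {-1..1}" for x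
  proof -
    have sub: "closed_segment a x \<subseteq> {-1..1}" using a x by (intro closed_segment_subset) auto
    have "norm (D i x - D i a) \<le> C * \<bar>x - a\<bar> ^ n * norm (x - a)"
    proof (rule field_differentiable_bound[of "closed_segment a x"])
      fix y assume y: "y \<in> closed_segment a x"
      then show "(D i has_real_derivative D (Suc i) y) (at y within closed_segment a x)"
        using D sub by (meson DERIV_subset subsetD)
      have "\<bar>y - a\<bar> \<le> \<bar>x - a\<bar>" using y by (auto simp: closed_segment_eq_real_ivl split: if_splits)
      then have "C * \<bar>y - a\<bar> ^ n \<le> C * \<bar>x - a\<bar> ^ n"
        using C(1) by (intro mult_left_mono power_mono) auto
      moreover have "\<bar>D (Suc i) y\<bar> \<le> C * \<bar>y - a\<bar> ^ n" using C(2) y sub by blast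
      ultimately show "norm (D (Suc i) y) \<le> C * \<bar>x - a\<bar> ^ n" by simp
    qed auto
    moreover have "D i a = 0" using Suc.prems[of i] by simp
    ultimately show ?thesis by (simp add: mult_ac)
  qed
  then show ?case using C(1) by blast
qed

text \<open>For \<open>t > 0\<close>, \<open>\<bar>ln t\<bar> \<le> t + 1 / t\<close> gives the
  bound \<open>t * t + 1 \<le> 5\<close>. The exponent \<open>e\<close> covers terms with and
  without a logarithm.\<close>

lemma abs_mult_ln_le:
  assumes "0 \<le> t" "t \<le> (2::real)" "e \<le> 1"
  shows "t * \<bar>ln t\<bar> ^ e \<le> 5"
proof (cases "t = 0 \<or> e = 0")
  case False
  then have t: "t > 0" and e: "e = 1" using assms by auto
  have "ln t \<le> t - 1" "ln (1 / t) \<le> 1 / t - 1" using t by (intro ln_le_minus_one; simp)+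
  then have "\<bar>ln t\<bar> \<le> t + 1 / t" using t by (simp add: ln_div) (smt (verit) divide_pos_pos)
  then have "t * \<bar>ln t\<bar> \<le> t * (t + 1 / t)" using t by (intro mult_left_mono) auto
  also have "\<dots> = t * t + 1" using t by (simp add: field_simps)
  also have "\<dots> \<le> 2 * 2 + 1" using assms by (intro add_right_mono mult_mono) auto
  finally show ?thesis using e by simp
qed (use assms in auto)

lemma DERIV_ln_abs_diff:
  fixes a x :: real
  assumes "x \<noteq> a"
  shows "((\<lambda>x. ln \<bar>x - a\<bar>) has_real_derivative inverse (x - a)) (at x within S)"
proof -
  \<comment> \<open>The square avoids a distinction by the sign of \<open>y - a\<close>; at
    \<open>y = a\<close> both sides are 0 because \<open>ln 0 = 0\<close>.\<close>
  have eq: "ln \<bar>y - a\<bar> = ln ((y - a)\<^sup>2) / 2" for y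
  proof (cases "y = a")
    case False
    then show ?thesis using ln_realpow[of "\<bar>y - a\<bar>" 2] by simp
  qed simp
  have "((\<lambda>y. ln ((y - a)\<^sup>2) / 2) has_real_derivative inverse (x - a)) (at x within S)"
  proof (rule DERIV_cong)
    have "((\<lambda>y. (y - a)\<^sup>2) has_real_derivative 2 * (x - a)) (at x within S)"
      by (auto intro!: derivative_eq_intros)
    from DERIV_chain2[OF DERIV_ln_divide this] assms
    show "((\<lambda>y. ln ((y - a)\<^sup>2) / 2) has_real_derivative 1 / (x - a)\<^sup>2 * (2 * (x - a)) / 2) (at x within S)"
      by (intro DERIV_cdivide) simp
  qed (use assms in \<open>simp add: divide_simps power2_eq_square\<close>)
  then show ?thesis unfolding eq .
qed

lemma DERIV_inverse_diff_power:
  fixes a x :: real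
  assumes "x \<noteq> a"
  shows "((\<lambda>x. inverse (x - a) ^ j) has_real_derivative - real j * inverse (x - a) ^ Suc j) (at x within S)"
proof (cases j)
  case (Suc k)
  have "((\<lambda>x. inverse (x - a)) has_real_derivative - (inverse (x - a) * inverse (x - a))) (at x within S)"
    by (rule derivative_eq_intros refl | use assms in simp)+
  from DERIV_power[OF this, of j] show ?thesis
    by (rule DERIV_cong) (simp add: Suc algebra_simps)
qed simp

text \<open>The span of such products is closed under differentiation: every term of a derivative
  has \<open>i\<close> or \<open>j\<close> raised by one. The zero of order \<open>R\<close> of
  \<open>D 0\<close> pays for this growth of \<open>i + j\<close>.\<close>

lemma bounded_deriv_log_product:
  fixes D :: "nat \<Rightarrow> real \<Rightarrow> real"
  assumes D: "\<And>k x. x \<in> {-1..1} \<Longrightarrow> (D k has_real_derivative D (Suc k) x) (at x within {-1..1})"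
    and a: "a \<in> {-1..1}" and zero: "\<And>l. l < R \<Longrightarrow> D l a = 0"
  shows "i + j + r + 1 < R \<Longrightarrow> e \<le> 1 \<Longrightarrow>
    bounded_deriv r (\<lambda>x. D i x * inverse (x - a) ^ j * ln \<bar>x - a\<bar> ^ e)"
proof (induction r arbitrary: i j e)
  have bound: "\<exists>C\<ge>0. \<forall>x\<in>{-1..1}. \<bar>D i x * inverse (x - a) ^ j * ln \<bar>x - a\<bar> ^ e\<bar> \<le> C * \<bar>x - a\<bar> ^ s"
    if R: "i + j + s + 1 \<le> R" and e: "e \<le> 1" for i j s e
  proof -
    \<comment> \<open>Of these \<open>j + s + 1\<close> orders of vanishing, \<open>j\<close> cancel
      the inverse power, one absorbs the logarithm, and \<open>s\<close> remain.\<close>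
    obtain C where C: "C \<ge> 0" "\<And>x. x \<in> {-1..1} \<Longrightarrow> \<bar>D i x\<bar> \<le> C * \<bar>x - a\<bar> ^ (j + s + 1)"
      using higher_zero_bound[where D = D, OF D a, of i "j + s + 1"] zero R by auto
    have "\<bar>D i x * inverse (x - a) ^ j * ln \<bar>x - a\<bar> ^ e\<bar> \<le> C * 5 * \<bar>x - a\<bar> ^ s"
      if x: "x \<in> {-1..1}" for x
    proof (cases "x = a")
      case True
      then show ?thesis using zero[of i] R C(1) by simp
    next
      case False
      define t where "t = \<bar>x - a\<bar>"
      have t: "0 < t" "t \<le> 2" using False x a by (auto simp: t_def)
      have "\<bar>D i x * inverse (x - a) ^ j * ln \<bar>x - a\<bar> ^ e\<bar> = \<bar>D i x\<bar> * (inverse t ^ j * \<bar>ln t\<bar> ^ e)"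
        by (simp add: t_def abs_mult power_abs)
      also have "\<dots> \<le> C * t ^ (j + s + 1) * (inverse t ^ j * \<bar>ln t\<bar> ^ e)"
        using C(2)[OF x] t by (intro mult_right_mono) (auto simp: t_def)
      also have "\<dots> = C * (t * \<bar>ln t\<bar> ^ e) * t ^ s"
        using t by (simp add: power_add field_simps)
      also have "\<dots> \<le> C * 5 * t ^ s"
        using abs_mult_ln_le[of t e] t e C(1) by (intro mult_right_mono mult_left_mono) auto
      finally show ?thesis by (simp add: t_def)
    qed
    then show ?thesis using C(1) by (intro exI[of _ "C * 5"]) auto
  qed
  {
    case 0
    then show ?case using bound[of i j 0 e] by auto
  next
    case (Suc r)
    define u where "u i j e x = D i x * inverse (x - a) ^ j * ln \<bar>x - a\<bar> ^ e" for i j e x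
    \<comment> \<open>For \<open>e = 0\<close> the truncated \<open>e - 1\<close> is harmless, as
      its factor \<open>real e\<close> is 0.\<close>
    define u' where "u' x = u (Suc i) j e x + (- real j * u i (Suc j) e x + real e * u i (Suc j) (e - 1) x)" for x
    have "(u i j e has_real_derivative u' x) (at x within {-1..1})" if x: "x \<in> {-1..1}" for x
    proof (cases "x = a")
      case True
      have 0: "u i j e a = 0" "u' a = 0" using zero[of i] zero[of "Suc i"] Suc.prems
        by (auto simp: u_def u'_def)
      \<comment> \<open>A quadratic bound forces the derivative 0 at \<open>a\<close>, in agreement
        with \<open>u' a = 0\<close>.\<close>
      obtain C where C: "C \<ge> 0" "\<And>x. x \<in> {-1..1} \<Longrightarrow> \<bar>u i j e x\<bar> \<le> C * \<bar>x - a\<bar> ^ 2"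
        using bound[of i j 2 e] Suc.prems unfolding u_def by auto
      have "((\<lambda>y. (u i j e y - u i j e a) / (y - a)) \<longlongrightarrow> 0) (at a within {-1..1})"
      proof (rule Lim_null_comparison)
        show "\<forall>\<^sub>F y in at a within {-1..1}. norm ((u i j e y - u i j e a) / (y - a)) \<le> C * \<bar>y - a\<bar>"
          unfolding eventually_at_filter
        proof (intro always_eventually allI impI)
          fix y assume "y \<noteq> a" "y \<in> {-1..1}"
          then show "norm ((u i j e y - u i j e a) / (y - a)) \<le> C * \<bar>y - a\<bar>"
            using C(2)[of y] 0 by (simp add: divide_le_eq power2_eq_square)
        qed
        have "((\<lambda>y. C * \<bar>y - a\<bar>) \<longlongrightarrow> C * \<bar>a - a\<bar>) (at a within {-1..1})"
          by (intro tendsto_intros)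
        then show "((\<lambda>y. C * \<bar>y - a\<bar>) \<longlongrightarrow> 0) (at a within {-1..1})" by simp
      qed
      then show ?thesis unfolding has_field_derivative_iff True 0(2) .
    next
      case False
      have "((\<lambda>x. ln \<bar>x - a\<bar> ^ e) has_real_derivative real e * (inverse (x - a) * ln \<bar>x - a\<bar> ^ (e - 1)))
          (at x within {-1..1})"
        using DERIV_power[OF DERIV_ln_abs_diff[OF False]] by simp
      from DERIV_mult[OF DERIV_mult[OF D[OF x] DERIV_inverse_diff_power[OF False]] this]
      show ?thesis unfolding u_def[abs_def] u'_def
        by (rule DERIV_cong) (simp add: algebra_simps)
    qed
    moreover have "bounded_deriv r u'"
      using Suc.IH[of "Suc i" j e] Suc.IH[of i "Suc j" e] Suc.IH[of i "Suc j" "e - 1"] Suc.prems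
      unfolding u'_def[abs_def] u_def
      by (intro bounded_deriv_add bounded_deriv_cmult) auto
    ultimately show ?case unfolding u_def[abs_def] bounded_deriv.simps by blast
  }
qed

subsection \<open>Rates of polynomial approximation\<close>

text \<open>The strict bound on the degree matches the polynomial part of \<open>log_space\<close>,
  whose powers are \<open>x ^ j\<close> with \<open>j < n1\<close>.\<close>

definition poly_approx_rate :: "real \<Rightarrow> nat \<Rightarrow> (real \<Rightarrow> real) \<Rightarrow> bool" where
  "poly_approx_rate \<alpha> m u \<longleftrightarrow> (\<exists>C\<ge>0. \<forall>n>0. \<exists>p. degree p < n \<and>
     (\<forall>x\<in>punctured \<alpha>. \<bar>u x - poly p x\<bar> \<le> C / real n ^ m))"

text \<open>The surplus degree \<open>d\<close> goes into the constant. For large \<open>n\<close>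
  the approximant for \<open>n - 1 - d \<ge> n / 2\<close> is taken; for small \<open>n\<close> the
  zero polynomial does, as \<open>u\<close> is bounded by the case \<open>n = 1\<close>.\<close>

lemma poly_approx_rateI:
  assumes C: "C \<ge> 0"
    and approx: "\<And>n. n > 0 \<Longrightarrow> \<exists>p. degree p \<le> n + d \<and> (\<forall>x\<in>punctured \<alpha>. \<bar>u x - poly p x\<bar> \<le> C / real n ^ m)"
  shows "poly_approx_rate \<alpha> m u"
proof -
  obtain p where p: "\<And>x. x \<in> punctured \<alpha> \<Longrightarrow> \<bar>u x - poly p x\<bar> \<le> C"
    using approx[of 1] by auto
  have "bounded (poly p ` {-1..1})"
    by (intro compact_imp_bounded compact_continuous_image continuous_intros) auto
  then obtain B where B: "\<forall>x\<in>{-1..1}. \<bar>poly p x\<bar> \<le> B" by (auto simp: bounded_iff)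
  define M where "M = \<bar>B\<bar> + C"
  have M0: "M \<ge> 0" using C by (simp add: M_def)
  have M: "\<bar>u x\<bar> \<le> M" if "x \<in> punctured \<alpha>" for x
  proof -
    have "\<bar>poly p x\<bar> \<le> B" using B that by (auto simp: punctured_def)
    with p[OF that] show "\<bar>u x\<bar> \<le> M" unfolding M_def by linarith
  qed
  define C' where "C' = M * (2 * d + 2) ^ m + C * 2 ^ m"
  have "\<exists>p. degree p < n \<and> (\<forall>x\<in>punctured \<alpha>. \<bar>u x - poly p x\<bar> \<le> C' / real n ^ m)" if n: "n > 0" for n
  proof (cases "n \<le> 2 * d + 2")
    case True
    have "M * real n ^ m \<le> M * (2 * d + 2) ^ m"
      using M0 True by (intro mult_left_mono) (auto simp flip: of_nat_power intro: power_mono)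
    also have "\<dots> \<le> C'" unfolding C'_def using C by simp
    finally have "M \<le> C' / real n ^ m" using n by (simp add: pos_le_divide_eq)
    then show ?thesis using n M by (intro exI[of _ 0]) force
  next
    case False
    define N where "N = n - 1 - d"
    have N: "N > 0" "N + d < n" "real n / 2 \<le> real N" using False by (auto simp: N_def)
    obtain p where p: "degree p \<le> N + d" "\<And>x. x \<in> punctured \<alpha> \<Longrightarrow> \<bar>u x - poly p x\<bar> \<le> C / real N ^ m"
      using approx[OF N(1)] by auto
    have "C / real N ^ m \<le> C / (real n / 2) ^ m"
      using N n C by (intro divide_left_mono power_mono mult_pos_pos) auto
    also have "\<dots> = C * 2 ^ m / real n ^ m" by (simp add: power_divide)
    also have "\<dots> \<le> C' / real n ^ m"
      unfolding C'_def using M0 by (intro divide_right_mono) auto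
    finally show ?thesis using p N(2) by (intro exI[of _ p]) force
  qed
  moreover have "C' \<ge> 0" unfolding C'_def using M0 C by simp
  ultimately show ?thesis unfolding poly_approx_rate_def by blast
qed

lemma poly_approx_rate_add:
  assumes "poly_approx_rate \<alpha> m u" "poly_approx_rate \<alpha> m v"
  shows "poly_approx_rate \<alpha> m (\<lambda>x. u x + v x)"
proof -
  obtain C where C: "C \<ge> 0" "\<And>n. n > 0 \<Longrightarrow> \<exists>p. degree p < n \<and>
     (\<forall>x\<in>punctured \<alpha>. \<bar>u x - poly p x\<bar> \<le> C / real n ^ m)"
    using assms(1) unfolding poly_approx_rate_def by blast
  obtain C' where C': "C' \<ge> 0" "\<And>n. n > 0 \<Longrightarrow> \<exists>p. degree p < n \<and>
     (\<forall>x\<in>punctured \<alpha>. \<bar>v x - poly p x\<bar> \<le> C' / real n ^ m)"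
    using assms(2) unfolding poly_approx_rate_def by blast
  have "\<exists>p. degree p < n \<and> (\<forall>x\<in>punctured \<alpha>. \<bar>u x + v x - poly p x\<bar> \<le> (C + C') / real n ^ m)"
    if n: "n > 0" for n
  proof -
    obtain p q where p: "degree p < n" "\<And>x. x \<in> punctured \<alpha> \<Longrightarrow> \<bar>u x - poly p x\<bar> \<le> C / real n ^ m"
      and q: "degree q < n" "\<And>x. x \<in> punctured \<alpha> \<Longrightarrow> \<bar>v x - poly q x\<bar> \<le> C' / real n ^ m"
      using C(2)[OF n] C'(2)[OF n] by blast
    have "\<bar>u x + v x - poly (p + q) x\<bar> \<le> (C + C') / real n ^ m" if "x \<in> punctured \<alpha>" for x
      using p(2)[OF that] q(2)[OF that] unfolding add_divide_distrib by simp
    then show ?thesis using p(1) q(1) by (intro exI[of _ "p + q"]) (auto intro: degree_add_less)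
  qed
  then show ?thesis unfolding poly_approx_rate_def using C(1) C'(1)
    by (intro exI[of _ "C + C'"]) auto
qed

lemma poly_approx_rate_cmult:
  assumes "poly_approx_rate \<alpha> m u"
  shows "poly_approx_rate \<alpha> m (\<lambda>x. c * u x)"
proof -
  obtain C where C: "C \<ge> 0" "\<And>n. n > 0 \<Longrightarrow> \<exists>p. degree p < n \<and>
     (\<forall>x\<in>punctured \<alpha>. \<bar>u x - poly p x\<bar> \<le> C / real n ^ m)"
    using assms(1) unfolding poly_approx_rate_def by blast
  have "\<exists>p. degree p < n \<and> (\<forall>x\<in>punctured \<alpha>. \<bar>c * u x - poly p x\<bar> \<le> \<bar>c\<bar> * C / real n ^ m)"
    if n: "n > 0" for n
  proof -
    obtain p where p: "degree p < n" "\<And>x. x \<in> punctured \<alpha> \<Longrightarrow> \<bar>u x - poly p x\<bar> \<le> C / real n ^ m"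
      using C(2)[OF n] by blast
    have "\<bar>c * u x - poly (smult c p) x\<bar> \<le> \<bar>c\<bar> * C / real n ^ m" if "x \<in> punctured \<alpha>" for x
      using mult_left_mono[OF p(2)[OF that], of "\<bar>c\<bar>"]
      by (simp add: abs_mult[symmetric] right_diff_distrib)
    then show ?thesis using p(1) n
      by (intro exI[of _ "smult c p"]) (auto intro: le_less_trans[OF degree_smult_le])
  qed
  then show ?thesis unfolding poly_approx_rate_def using C(1)
    by (intro exI[of _ "\<bar>c\<bar> * C"]) auto
qed

lemma poly_approx_rate_cong:
  assumes "poly_approx_rate \<alpha> m u" "\<And>x. x \<in> punctured \<alpha> \<Longrightarrow> u x = v x"
  shows "poly_approx_rate \<alpha> m v"
  using assms unfolding poly_approx_rate_def by simp

lemma poly_approx_rate_sum: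
  assumes "finite A" "\<And>i. i \<in> A \<Longrightarrow> poly_approx_rate \<alpha> m (u i)"
  shows "poly_approx_rate \<alpha> m (\<lambda>x. \<Sum>i\<in>A. u i x)"
  using assms
proof (induction A rule: finite_induct)
  case empty
  then show ?case unfolding poly_approx_rate_def by (auto intro!: exI[of _ 0])
next
  case (insert i A)
  then show ?case by (simp add: poly_approx_rate_add)
qed

text \<open>Two derivatives pay for one power of \<open>n\<close>, since each gains a factor
  \<open>1 / sqrt n\<close>.\<close>

lemma poly_approx_rate_bounded_deriv:
  assumes "bounded_deriv (2 * m) u"
  shows "poly_approx_rate \<alpha> m u"
proof -
  obtain C where C: "C \<ge> 0" "\<And>n. n > 0 \<Longrightarrow> \<exists>p. degree p \<le> n + 2 * m \<and>
      (\<forall>x\<in>{-1..1}. \<bar>u x - poly p x\<bar> \<le> C / sqrt n ^ (2 * m))"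
    using bounded_deriv_polynomial_approximation[OF assms] by blast
  have "sqrt n ^ (2 * m) = real n ^ m" for n by (simp add: power_mult)
  with C(2) have "\<exists>p. degree p \<le> n + 2 * m \<and> (\<forall>x\<in>punctured \<alpha>. \<bar>u x - poly p x\<bar> \<le> C / real n ^ m)"
    if "n > 0" for n using that unfolding punctured_def by (metis DiffD1)
  with C(1) show ?thesis by (rule poly_approx_rateI)
qed

lemma poly_approx_rate_mono:
  assumes "poly_approx_rate \<alpha> k u" "m \<le> k"
  shows "poly_approx_rate \<alpha> m u"
proof -
  obtain C where C: "C \<ge> 0" "\<And>n. n > 0 \<Longrightarrow> \<exists>p. degree p < n \<and>
     (\<forall>x\<in>punctured \<alpha>. \<bar>u x - poly p x\<bar> \<le> C / real n ^ k)"
    using assms(1) unfolding poly_approx_rate_def by blast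
  have "C / real n ^ k \<le> C / real n ^ m" if "n > 0" for n
    using C(1) assms(2) that by (intro divide_left_mono power_increasing) auto
  with C show ?thesis unfolding poly_approx_rate_def by (meson order_trans)
qed

lemma poly_approx_rate_power_ln:
  assumes "\<alpha> \<in> {-1..1}" "k > 0"
  shows "poly_approx_rate \<alpha> k (\<lambda>x. (x - \<alpha>) ^ k * ln \<bar>x - \<alpha>\<bar>)"
proof -
  obtain m where k: "k = Suc m" using assms(2) by (cases k) auto
  from log_power_polynomial_approximation[OF assms(1), of m, folded k] obtain C where
    "C \<ge> 0" "\<And>n. n > 0 \<Longrightarrow> \<exists>p :: real poly. degree p \<le> n + 2 * k \<and>
      (\<forall>x\<in>punctured \<alpha>. \<bar>(x - \<alpha>) ^ k * ln \<bar>x - \<alpha>\<bar> - poly p x\<bar> \<le> C / real n ^ k)"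
    unfolding punctured_def by blast
  then show ?thesis by (rule poly_approx_rateI)
qed

lemma poly_eq_sum_lessThan:
  fixes p :: "real poly"
  assumes "degree p < n"
  shows "poly p x = (\<Sum>k<n. coeff p k * x ^ k)"
  unfolding poly_altdef
  by (rule sum.mono_neutral_left) (use assms in \<open>auto intro: coeff_eq_0\<close>)

text \<open>Write \<open>g2 = D' 0 + P\<close> with \<open>D' 0\<close> flat at
  \<open>\<alpha>\<close>, and expand \<open>P\<close> in powers of \<open>x - \<alpha>\<close>. The
  first \<open>m\<close> powers form \<open>q\<close>; the higher ones times the logarithm, and
  \<open>D' 0\<close> times the logarithm, have the required rate.\<close>

lemma log_kernel_approx_rate:
  assumes \<alpha>: "\<alpha> \<in> {-1..1}" and m: "m > 0"
    and g1: "smooth_on_interval g1" and g2: "smooth_on_interval g2"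
  shows "\<exists>q. degree q < m \<and> poly_approx_rate \<alpha> m (\<lambda>x. g1 x + (g2 x - poly q x) * ln \<bar>x - \<alpha>\<bar>)"
proof -
  obtain D where D: "\<And>x. x \<in> {-1..1} \<Longrightarrow> D 0 x = g2 x"
    "\<And>k x. x \<in> {-1..1} \<Longrightarrow> (D k has_real_derivative D (Suc k) x) (at x within {-1..1})"
    using g2 unfolding smooth_on_interval_def by blast
  \<comment> \<open>The least order that allows \<open>2 * m\<close> bounded derivatives in
    \<open>bounded_deriv_log_product\<close> with \<open>i = j = 0\<close>.\<close>
  define R where "R = 2 * m + 2"
  obtain P where P: "\<And>i. i < R \<Longrightarrow> poly ((pderiv ^^ i) P) \<alpha> = D i \<alpha>"
    using poly_with_derivatives[of R \<alpha> "\<lambda>i. D i \<alpha>"] by blast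
  define D' where "D' k x = D k x - poly ((pderiv ^^ k) P) x" for k x
  have "(D' k has_real_derivative D' (Suc k) x) (at x within {-1..1})" if "x \<in> {-1..1}" for k x
    unfolding D'_def[abs_def]
    using DERIV_diff[OF D(2)[OF that] DERIV_subset[OF poly_DERIV]] by simp
  moreover have "D' l \<alpha> = 0" if "l < R" for l using P[OF that] by (simp add: D'_def)
  ultimately have "bounded_deriv (2 * m) (\<lambda>x. D' 0 x * inverse (x - \<alpha>) ^ 0 * ln \<bar>x - \<alpha>\<bar> ^ 1)"
    using \<alpha> by (intro bounded_deriv_log_product[where R = R]) (auto simp: R_def)
  then have smooth_part: "poly_approx_rate \<alpha> m (\<lambda>x. D' 0 x * ln \<bar>x - \<alpha>\<bar>)"
    using poly_approx_rate_bounded_deriv by simp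
  define P' where "P' = P \<circ>\<^sub>p [:\<alpha>, 1:]"
  \<comment> \<open>Large enough to exceed the degree of \<open>P'\<close> and to allow a split of
    the sum at \<open>m\<close>.\<close>
  define n where "n = m + Suc (degree P')"
  have P_eq: "poly P x = (\<Sum>j<n. coeff P' j * (x - \<alpha>) ^ j)" for x
  proof -
    have "poly P x = poly P' (x - \<alpha>)" by (simp add: P'_def poly_pcompose)
    also have "\<dots> = (\<Sum>j<n. coeff P' j * (x - \<alpha>) ^ j)" by (rule poly_eq_sum_lessThan) (simp add: n_def)
    finally show ?thesis .
  qed
  define q where "q = (\<Sum>j<m. smult (coeff P' j) ([:-\<alpha>, 1:] ^ j))"
  have "degree q < m"
    unfolding q_def
  proof (rule degree_sum_less[OF _ m])
    fix j assume "j \<in> {..<m}"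
    moreover have "degree (smult (coeff P' j) ([:-\<alpha>, 1:] ^ j)) \<le> j"
      using degree_power_le[of "[:-\<alpha>, 1:]" j] by (intro order.trans[OF degree_smult_le]) simp
    ultimately show "degree (smult (coeff P' j) ([:-\<alpha>, 1:] ^ j)) < m" by simp
  qed
  moreover have "poly_approx_rate \<alpha> m (\<lambda>x. g1 x + (g2 x - poly q x) * ln \<bar>x - \<alpha>\<bar>)"
  proof (rule poly_approx_rate_cong)
    have "poly_approx_rate \<alpha> m (\<lambda>x. coeff P' j * ((x - \<alpha>) ^ j * ln \<bar>x - \<alpha>\<bar>))" if "j \<in> {m..<n}" for j
      using that m \<alpha>
      by (intro poly_approx_rate_cmult poly_approx_rate_mono[OF poly_approx_rate_power_ln]) auto
    then show "poly_approx_rate \<alpha> m (\<lambda>x. g1 x + (D' 0 x * ln \<bar>x - \<alpha>\<bar> +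
        (\<Sum>j\<in>{m..<n}. coeff P' j * ((x - \<alpha>) ^ j * ln \<bar>x - \<alpha>\<bar>))))"
      by (intro poly_approx_rate_add[OF poly_approx_rate_bounded_deriv
            [OF smooth_on_interval_bounded_deriv[OF g1]]]
          poly_approx_rate_add[OF smooth_part] poly_approx_rate_sum) simp_all
    fix x assume x: "x \<in> punctured \<alpha>"
    have "poly P x = poly q x + (\<Sum>j\<in>{m..<n}. coeff P' j * (x - \<alpha>) ^ j)"
    proof -
      have "poly q x = (\<Sum>j<m. coeff P' j * (x - \<alpha>) ^ j)" by (simp add: q_def poly_sum)
      then show ?thesis
        unfolding P_eq lessThan_atLeast0
        by (simp add: sum.atLeastLessThan_concat n_def)
    qed
    moreover have "D' 0 x = g2 x - poly P x" using D(1) x by (simp add: D'_def punctured_def)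
    ultimately have "(g2 x - poly q x) * ln \<bar>x - \<alpha>\<bar> =
        (D' 0 x + (\<Sum>j\<in>{m..<n}. coeff P' j * (x - \<alpha>) ^ j)) * ln \<bar>x - \<alpha>\<bar>" by simp
    then show "g1 x + (D' 0 x * ln \<bar>x - \<alpha>\<bar> +
        (\<Sum>j\<in>{m..<n}. coeff P' j * ((x - \<alpha>) ^ j * ln \<bar>x - \<alpha>\<bar>))) =
        g1 x + (g2 x - poly q x) * ln \<bar>x - \<alpha>\<bar>"
      by (simp add: distrib_right sum_distrib_right mult.assoc)
  qed
  ultimately show ?thesis by blast
qed

subsection \<open>The interpolation operator\<close>

lemma interp_op_interpolates:
  assumes "uniquely_solvable \<alpha> n1 n2 X" "continuous_on (punctured \<alpha>) f"
  shows "interpolates \<alpha> n1 n2 X f (interp_op \<alpha> n1 n2 X f)"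
proof -
  have "\<exists>!s. interpolates \<alpha> n1 n2 X f s" using assms unfolding uniquely_solvable_def by simp
  then show ?thesis unfolding interp_op_def by (rule theI')
qed

lemma interp_op_eqI:
  assumes "uniquely_solvable \<alpha> n1 n2 X" "continuous_on (punctured \<alpha>) f"
    and "interpolates \<alpha> n1 n2 X f s"
  shows "interp_op \<alpha> n1 n2 X f = s"
proof -
  have "\<exists>!s. interpolates \<alpha> n1 n2 X f s" using assms unfolding uniquely_solvable_def by simp
  then show ?thesis using interp_op_interpolates[OF assms(1,2)] assms(3) by metis
qed

lemma log_spaceI:
  "(\<lambda>x\<in>punctured \<alpha>. (\<Sum>j<n1. a j * x ^ j) + (\<Sum>k<n2. b k * (x ^ k * ln \<bar>x - \<alpha>\<bar>)))
     \<in> log_space \<alpha> n1 n2"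
  unfolding log_space_def by blast

lemma log_space_diff:
  assumes "s \<in> log_space \<alpha> n1 n2" "t \<in> log_space \<alpha> n1 n2"
  shows "(\<lambda>x\<in>punctured \<alpha>. s x - t x) \<in> log_space \<alpha> n1 n2"
proof -
  obtain a b where s: "s = (\<lambda>x\<in>punctured \<alpha>.
        (\<Sum>j<n1. a j * x ^ j) + (\<Sum>k<n2. b k * (x ^ k * ln \<bar>x - \<alpha>\<bar>)))"
    using assms(1) unfolding log_space_def by blast
  obtain a' b' where t: "t = (\<lambda>x\<in>punctured \<alpha>.
        (\<Sum>j<n1. a' j * x ^ j) + (\<Sum>k<n2. b' k * (x ^ k * ln \<bar>x - \<alpha>\<bar>)))"
    using assms(2) unfolding log_space_def by blast
  have eq: "(\<lambda>x\<in>punctured \<alpha>. s x - t x) = (\<lambda>x\<in>punctured \<alpha>.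
        (\<Sum>j<n1. (a j - a' j) * x ^ j) + (\<Sum>k<n2. (b k - b' k) * (x ^ k * ln \<bar>x - \<alpha>\<bar>)))"
    unfolding s t by (rule restrict_ext) (simp add: left_diff_distrib sum_subtractf)
  show ?thesis unfolding eq by (rule log_spaceI)
qed

text \<open>Functions of norm 0 are excluded from the supremum that defines
  \<open>op_norm_1_inf\<close>; for them uniqueness makes the interpolant 0. Otherwise the norm is
  finite and nonzero, so dividing and multiplying by it cancels in \<open>ennreal\<close>.\<close>

lemma norm_1_interp_op_le:
  assumes "uniquely_solvable \<alpha> n1 n2 X" "X \<subseteq> punctured \<alpha>" "continuous_on (punctured \<alpha>) f"
    and bound: "\<And>x. x \<in> punctured \<alpha> \<Longrightarrow> \<bar>f x\<bar> \<le> E"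
  shows "norm_1 \<alpha> (interp_op \<alpha> n1 n2 X f) \<le> op_norm_1_inf \<alpha> (interp_op \<alpha> n1 n2 X) * ennreal E"
proof (cases "norm_inf \<alpha> f = 0")
  case True
  then have zero: "f x = 0" if "x \<in> punctured \<alpha>" for x
  proof -
    have "ennreal \<bar>f x\<bar> \<le> norm_inf \<alpha> f" unfolding norm_inf_def using that by (rule SUP_upper)
    with True show ?thesis by simp
  qed
  have "(\<lambda>x\<in>punctured \<alpha>. 0) \<in> log_space \<alpha> n1 n2"
    using log_spaceI[where a = "\<lambda>_. 0" and b = "\<lambda>_. 0"] by simp
  then have "interp_op \<alpha> n1 n2 X f = (\<lambda>x\<in>punctured \<alpha>. 0)"
    using assms(2) zero by (intro interp_op_eqI assms) (auto simp: interpolates_def)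
  then have "norm_1 \<alpha> (interp_op \<alpha> n1 n2 X f) = (\<integral>\<^sup>+ x. 0 \<partial>(lborel :: real measure))"
    unfolding norm_1_def by (intro nn_integral_cong) (simp add: indicator_def)
  then show ?thesis by simp
next
  case False
  have le: "norm_inf \<alpha> f \<le> ennreal E"
    unfolding norm_inf_def using bound by (intro SUP_least ennreal_leI)
  then have "norm_inf \<alpha> f \<noteq> \<infinity>" by (auto simp: top_unique)
  then have "norm_1 \<alpha> (interp_op \<alpha> n1 n2 X f) =
      norm_1 \<alpha> (interp_op \<alpha> n1 n2 X f) / norm_inf \<alpha> f * norm_inf \<alpha> f"
    using False by (simp add: ennreal_divide_times ennreal_divide_self less_top)
  also have "\<dots> \<le> op_norm_1_inf \<alpha> (interp_op \<alpha> n1 n2 X) * ennreal E"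
    unfolding op_norm_1_inf_def using False assms(3) le by (intro mult_mono SUP_upper) auto
  finally show ?thesis .
qed

text \<open>The factor 2 is the length of the interval. Membership in \<open>log_space\<close> makes
  \<open>s\<close> measurable, so that the integral of the majorant splits.\<close>

lemma norm_1_diff_le:
  assumes E: "E \<ge> 0" and bound: "\<And>x. x \<in> punctured \<alpha> \<Longrightarrow> \<bar>f x\<bar> \<le> E"
    and s: "s \<in> log_space \<alpha> n1 n2"
  shows "norm_1 \<alpha> (\<lambda>x. f x - s x) \<le> ennreal (2 * E) + norm_1 \<alpha> s"
proof -
  obtain a b where s_eq: "s = (\<lambda>x\<in>punctured \<alpha>.
        (\<Sum>j<n1. a j * x ^ j) + (\<Sum>k<n2. b k * (x ^ k * ln \<bar>x - \<alpha>\<bar>)))"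
    using s unfolding log_space_def by blast
  have [measurable]: "punctured \<alpha> \<in> sets borel" unfolding punctured_def by simp
  have "(\<lambda>x. ennreal \<bar>s x\<bar> * indicator (punctured \<alpha>) x) = (\<lambda>x. ennreal
        \<bar>(\<Sum>j<n1. a j * x ^ j) + (\<Sum>k<n2. b k * (x ^ k * ln \<bar>x - \<alpha>\<bar>))\<bar> * indicator (punctured \<alpha>) x)"
    unfolding s_eq by (auto simp: indicator_def)
  moreover have "\<dots> \<in> borel_measurable lborel" by measurable
  ultimately have meas: "(\<lambda>x. ennreal \<bar>s x\<bar> * indicator (punctured \<alpha>) x) \<in> borel_measurable lborel"
    by simp
  have "norm_1 \<alpha> (\<lambda>x. f x - s x) \<le>
      (\<integral>\<^sup>+ x. ennreal E * indicator (punctured \<alpha>) x + ennreal \<bar>s x\<bar> * indicator (punctured \<alpha>) x \<partial>lborel)"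
    unfolding norm_1_def
  proof (rule nn_integral_mono)
    fix x
    show "ennreal \<bar>f x - s x\<bar> * indicator (punctured \<alpha>) x \<le>
        ennreal E * indicator (punctured \<alpha>) x + ennreal \<bar>s x\<bar> * indicator (punctured \<alpha>) x"
    proof (cases "x \<in> punctured \<alpha>")
      case True
      have "\<bar>f x - s x\<bar> \<le> E + \<bar>s x\<bar>" using bound[OF True] by linarith
      then show ?thesis using True E by (simp add: ennreal_leI flip: ennreal_plus)
    qed simp
  qed
  also have "\<dots> = ennreal E * emeasure lborel (punctured \<alpha>) + norm_1 \<alpha> s"
    unfolding norm_1_def using meas by (subst nn_integral_add) (auto simp: nn_integral_cmult_indicator)
  also have "emeasure lborel (punctured \<alpha>) \<le> emeasure lborel {-1..1::real}"
    by (rule emeasure_mono) (auto simp: punctured_def)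
  also have "emeasure lborel {-1..1::real} = 2" by simp
  also have "ennreal E * 2 = ennreal (2 * E)"
    using E by (simp add: ennreal_mult mult.commute)
  finally show ?thesis by (simp add: add_mono mult_left_mono)
qed

section \<open>The bound on the interpolation error\<close>

theorem corollary2p4:
  fixes \<alpha> :: real and n2 :: nat and K g1 g2 :: "real \<Rightarrow> real"
  assumes "\<alpha> \<in> {-1..1}"
    and "n2 \<ge> 1"
    and "smooth_on_interval g1"
    and "smooth_on_interval g2"
    and "\<And>x. x \<in> punctured \<alpha> \<Longrightarrow> K x = g1 x + g2 x * ln \<bar>x - \<alpha>\<bar>"
  shows "\<exists>c::real. c > 0 \<and>
    (\<forall>(n1::nat) (Y::real set).
       n1 \<ge> n2 + 2 \<longrightarrow>
       card Y = n2 \<longrightarrow>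
       Y \<inter> chebyshev_points n1 = {} \<longrightarrow>
       chebyshev_points n1 \<union> Y \<subseteq> punctured \<alpha> \<longrightarrow>
       uniquely_solvable \<alpha> n1 n2 (chebyshev_points n1 \<union> Y) \<longrightarrow>
       (let S = interp_op \<alpha> n1 n2 (chebyshev_points n1 \<union> Y) in
        norm_1 \<alpha> (\<lambda>x. K x - S K x) \<le>
          ennreal (8 * c) * (1 + op_norm_1_inf \<alpha> S) /
          ennreal (pi * real n2 * (\<Prod>i = 1..n2. real n1 - real i))))"
proof -
  obtain q C where q: "degree q < n2" and C: "C \<ge> 0" and
    rate: "\<And>n. n > 0 \<Longrightarrow> \<exists>p. degree p < n \<and> (\<forall>x\<in>punctured \<alpha>.
      \<bar>g1 x + (g2 x - poly q x) * ln \<bar>x - \<alpha>\<bar> - poly p x\<bar> \<le> C / real n ^ n2)"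
    using log_kernel_approx_rate[OF assms(1) _ assms(3,4), of n2] assms(2)
    unfolding poly_approx_rate_def by auto
  have cont_g: "continuous_on (punctured \<alpha>) g" if "smooth_on_interval g" for g
  proof -
    have "bounded_deriv 1 g" using that by (rule smooth_on_interval_bounded_deriv)
    then have "continuous_on {-1..1} g" by (auto intro: DERIV_continuous_on)
    then show ?thesis by (rule continuous_on_subset) (auto simp: punctured_def)
  qed
  have cont_ln: "continuous_on (punctured \<alpha>) (\<lambda>x. ln \<bar>x - \<alpha>\<bar>)"
    by (intro continuous_intros) (auto simp: punctured_def)
  have "continuous_on (punctured \<alpha>) (\<lambda>x. g1 x + g2 x * ln \<bar>x - \<alpha>\<bar>)"
    using assms(3,4) by (intro continuous_intros cont_g cont_ln)
  then have cont_K: "continuous_on (punctured \<alpha>) K"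
    by (rule continuous_on_eq) (simp add: assms(5))
  \<comment> \<open>Chosen so that \<open>8 * c / (pi * n2)\<close> equals
    \<open>2 * (C + 1)\<close>; the added 1 makes \<open>c\<close> positive even if
    \<open>C = 0\<close>.\<close>
  define c where "c = pi * real n2 * (C + 1) / 4"
  have "c > 0" using assms(2) C by (simp add: c_def)
  moreover have "norm_1 \<alpha> (\<lambda>x. K x - S K x) \<le> ennreal (8 * c) * (1 + op_norm_1_inf \<alpha> S) /
          ennreal (pi * real n2 * (\<Prod>i = 1..n2. real n1 - real i))"
    if n1: "n1 \<ge> n2 + 2" and X: "X \<subseteq> punctured \<alpha>" and solv: "uniquely_solvable \<alpha> n1 n2 X"
      and S: "S = interp_op \<alpha> n1 n2 X" for n1 X S
  proof -
    define E where "E = (C + 1) / real n1 ^ n2"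
    have E: "E \<ge> 0" using C by (simp add: E_def)
    obtain p where p: "degree p < n1" "\<And>x. x \<in> punctured \<alpha> \<Longrightarrow>
      \<bar>g1 x + (g2 x - poly q x) * ln \<bar>x - \<alpha>\<bar> - poly p x\<bar> \<le> C / real n1 ^ n2"
      using rate[of n1] n1 by auto
    define v where "v = (\<lambda>x\<in>punctured \<alpha>. poly p x + poly q x * ln \<bar>x - \<alpha>\<bar>)"
    have v: "v \<in> log_space \<alpha> n1 n2"
      unfolding v_def poly_eq_sum_lessThan[OF p(1)] poly_eq_sum_lessThan[OF q]
        sum_distrib_right mult.assoc by (rule log_spaceI)
    define e where "e x = K x - v x" for x
    have e: "\<bar>e x\<bar> \<le> E" if x: "x \<in> punctured \<alpha>" for x
    proof -
      have "e x = g1 x + (g2 x - poly q x) * ln \<bar>x - \<alpha>\<bar> - poly p x"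
        using x by (simp add: e_def v_def assms(5) algebra_simps)
      then have "\<bar>e x\<bar> \<le> C / real n1 ^ n2" using p(2)[OF x] by simp
      also have "\<dots> \<le> E" unfolding E_def by (intro divide_right_mono) auto
      finally show ?thesis .
    qed
    have "continuous_on (punctured \<alpha>) (\<lambda>x. poly p x + poly q x * ln \<bar>x - \<alpha>\<bar>)"
      by (intro continuous_intros cont_ln)
    then have "continuous_on (punctured \<alpha>) v"
      by (rule continuous_on_eq) (simp add: v_def)
    then have cont_e: "continuous_on (punctured \<alpha>) e"
      unfolding e_def[abs_def] by (intro continuous_intros cont_K)
    have SK: "interpolates \<alpha> n1 n2 X K (S K)"
      unfolding S using solv cont_K by (rule interp_op_interpolates)
    \<comment> \<open>Since \<open>v\<close> lies in the space, so does \<open>S K - v\<close>,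
      which agrees with \<open>e\<close> on \<open>X\<close>. Uniqueness identifies it with
      \<open>S e\<close>, hence \<open>K - S K = e - S e\<close> on
      \<open>punctured \<alpha>\<close>.\<close>
    then have "interpolates \<alpha> n1 n2 X e (\<lambda>x\<in>punctured \<alpha>. S K x - v x)"
      using X v log_space_diff by (auto simp: interpolates_def e_def)
    then have Se: "S e = (\<lambda>x\<in>punctured \<alpha>. S K x - v x)"
      unfolding S by (rule interp_op_eqI[OF solv cont_e])
    have "norm_1 \<alpha> (\<lambda>x. K x - S K x) = norm_1 \<alpha> (\<lambda>x. e x - S e x)"
      unfolding norm_1_def by (intro nn_integral_cong) (simp add: indicator_def Se e_def)
    also have "\<dots> \<le> ennreal (2 * E) + norm_1 \<alpha> (S e)"
      using interp_op_interpolates[OF solv cont_e]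
      by (intro norm_1_diff_le[OF E e]) (auto simp: S interpolates_def)
    also have "\<dots> \<le> ennreal (2 * E) + op_norm_1_inf \<alpha> S * ennreal (2 * E)"
    proof (rule add_left_mono)
      have "norm_1 \<alpha> (S e) \<le> op_norm_1_inf \<alpha> S * ennreal E"
        unfolding S by (rule norm_1_interp_op_le[OF solv X cont_e e])
      also have "\<dots> \<le> op_norm_1_inf \<alpha> S * ennreal (2 * E)"
        using E by (intro mult_left_mono ennreal_leI) auto
      finally show "norm_1 \<alpha> (S e) \<le> op_norm_1_inf \<alpha> S * ennreal (2 * E)" .
    qed
    also have "\<dots> = ennreal (2 * E) * (1 + op_norm_1_inf \<alpha> S)"
      by (simp add: distrib_right distrib_left mult.commute)
    also have "\<dots> \<le> ennreal (8 * c / (pi * real n2 * (\<Prod>i = 1..n2. real n1 - real i))) * (1 + op_norm_1_inf \<alpha> S)"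
    proof (intro mult_right_mono ennreal_leI)
      let ?\<Pi> = "\<Prod>i = 1..n2. real n1 - real i"
      have pos: "?\<Pi> > 0" using n1 by (intro prod_pos) auto
      \<comment> \<open>The rate in powers of \<open>n1\<close> is stronger than the claimed one:
        each factor \<open>n1 - i\<close> is positive and at most \<open>n1\<close>.\<close>
      have "?\<Pi> \<le> (\<Prod>i = 1..n2. real n1)" using n1 by (intro prod_mono) auto
      then have "?\<Pi> \<le> real n1 ^ n2" by simp
      then have "2 * E \<le> 2 * ((C + 1) / ?\<Pi>)"
        unfolding E_def using C pos n1 by (intro mult_left_mono divide_left_mono) auto
      also have "\<dots> = 8 * c / (pi * real n2 * ?\<Pi>)"
        unfolding c_def using assms(2) by simp
      finally show "2 * E \<le> 8 * c / (pi * real n2 * ?\<Pi>)" .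
    qed simp
    also have "\<dots> = ennreal (8 * c) * (1 + op_norm_1_inf \<alpha> S) /
          ennreal (pi * real n2 * (\<Prod>i = 1..n2. real n1 - real i))"
    proof -
      have "(\<Prod>i = 1..n2. real n1 - real i) > 0" using n1 by (intro prod_pos) auto
      then have "pi * real n2 * (\<Prod>i = 1..n2. real n1 - real i) > 0" using assms(2) by simp
      then show ?thesis using \<open>c > 0\<close>
        by (simp add: divide_ennreal[symmetric] ennreal_divide_times ennreal_times_divide mult.commute)
    qed
    finally show ?thesis .
  qed
  ultimately show ?thesis unfolding Let_def by blast
qed

end
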